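(* Let $\nu\in\mathbb{R}$ and $-\nu<u^1<u^2<u^3$. Put $R(\lambda)=(\lambda+\nu)(\lambda-u^1)(\lambda-u^2)(\lambda-u^3)$, $k=2\pi\left(\oint_a(\lambda+\nu)d\lambda/\sqrt{R(\lambda)}\right)^{-1}$ ($a$ a cycle on $y^2=R(\lambda)$ encircling $[u^1,u^2]$), $\omega=(2\nu+u^1+u^2+u^3)k$, and $C^i=\partial_{u^i}\omega/\partial_{u^i}k$, $i=1,2,3$ (these are the characteristic speeds of the one-phase Whitham modulation equations $\partial_tu^i+C^i(\boldsymbol u)\partial_xu^i=0$ of the Camassa--Holm equation ${\tt u}_t+3{\tt u}{\tt u}_x={\tt u}_{xxt}+2{\tt u}_x{\tt u}_{xx}+{\tt u}{\tt u}_{xxx}-2\nu{\tt u}_x$ in Riemann invariants). Then $$C^1=u^1+u^2+u^3+2\nu+\frac{2(u^1+\nu)(u^1-u^2)\Lambda(K(s),\rho,s)}{(u^2+\nu)[K(s)-E(s)]},$$ $$C^2=u^1+u^2+u^3+2\nu+\frac{2(u^2-u^1)\Lambda(K(s),\rho,s)}{K(s)-\dfrac{(u^2+\nu)(u^3-u^1)}{(u^1+\nu)(u^3-u^2)}E(s)},$$ $$C^3=u^1+u^2+u^3+2\nu+\frac{2(u^1+\nu)(u^3-u^2)\Lambda(K(s),\rho,s)}{(u^2+\nu)E(s)},$$ where $s^2=\dfrac{(u^2-u^1)(u^3+\nu)}{(u^3-u^1)(u^2+\nu)}$ and $\rho^2=\dfrac{u^2-u^1}{u^2+\nu}$. The equations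 $\partial_tu^i+C^i(\boldsymbol u)\partial_xu^i=0$ are hyperbolic, and for $-\nu<u^1<u^2<u^3$ the speeds satisfy $C^1(\boldsymbol u)<C^3(\boldsymbol u)$ and $C^2(\boldsymbol u)<C^3(\boldsymbol u)$. In the limit when two Riemann invariants coalesce, the modulation equations reduce to the dispersionless Camassa--Holm equation $\partial_t{\tt u}+(3{\tt u}+2\nu)\partial_x{\tt u}=0$ (namely, when $u^2,u^3\to v$ one has $C^2=C^3$ in the limit and $C^1\to3u^1+2\nu$; when $u^1,u^2$ coalesce one has $C^1=C^2$ in the limit and $C^3\to3u^3+2\nu$).
   Context: $K(s)=\int_0^{\pi/2}d\psi/\sqrt{1-s^2\sin^2\psi}$ and $E(s)=\int_0^{\pi/2}\sqrt{1-s^2\sin^2\psi}\,d\psi$ are the complete elliptic integrals of the first and second kind with modulus $s$, and $\Lambda(K(s),\rho,s)=\int_0^{K(s)}\frac{dv}{1-\rho^2\,\mathrm{sn}^2 v}$ is the complete elliptic integral of the third kind, with $\mathrm{sn}$ the Jacobi elliptic function of modulus $s$. *)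

theory Defs
  imports "HOL-Analysis.Analysis"
begin

definition ellK :: "real \<Rightarrow> real" where
  "ellK s = integral {0..pi/2} (\<lambda>\<psi>. 1 / sqrt (1 - s^2 * (sin \<psi>)^2))"

definition ellE :: "real \<Rightarrow> real" where
  "ellE s = integral {0..pi/2} (\<lambda>\<psi>. sqrt (1 - s^2 * (sin \<psi>)^2))"

definition ellF :: "real \<Rightarrow> real \<Rightarrow> real" where
  "ellF s \<phi> = (if 0 \<le> \<phi> then integral {0..\<phi>} (\<lambda>\<psi>. 1 / sqrt (1 - s^2 * (sin \<psi>)^2))
               else - integral {\<phi>..0} (\<lambda>\<psi>. 1 / sqrt (1 - s^2 * (sin \<psi>)^2)))"

definition jacobi_am :: "real \<Rightarrow> real \<Rightarrow> real" where
  "jacobi_am s v = (THE \<phi>. ellF s \<phi> = v)"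

definition jacobi_sn :: "real \<Rightarrow> real \<Rightarrow> real" where
  "jacobi_sn s v = sin (jacobi_am s v)"

definition ellLambda :: "real \<Rightarrow> real \<Rightarrow> real" where
  "ellLambda \<rho> s = integral {0..ellK s} (\<lambda>v. 1 / (1 - \<rho>^2 * (jacobi_sn s v)^2))"

definition Rpoly :: "real \<Rightarrow> real \<Rightarrow> real \<Rightarrow> real \<Rightarrow> real \<Rightarrow> real" where
  "Rpoly nu u1 u2 u3 l = (l + nu) * (l - u1) * (l - u2) * (l - u3)"

text \<open>The a-cycle encircles the cut [u1,u2], on which R > 0; the cycle integral
  oint_a (l+nu) dl / sqrt R equals 2 * int_{u1}^{u2} (l+nu) dl / sqrt R(l)
  (orientation chosen so that k > 0).\<close>

definition wavenumber :: "real \<Rightarrow> real \<Rightarrow> real \<Rightarrow> real \<Rightarrow> real" where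
  "wavenumber nu u1 u2 u3 =
     2 * pi / (2 * integral {u1..u2} (\<lambda>l. (l + nu) / sqrt (Rpoly nu u1 u2 u3 l)))"

definition frequency :: "real \<Rightarrow> real \<Rightarrow> real \<Rightarrow> real \<Rightarrow> real" where
  "frequency nu u1 u2 u3 = (2 * nu + u1 + u2 + u3) * wavenumber nu u1 u2 u3"

definition speed1 :: "real \<Rightarrow> real \<Rightarrow> real \<Rightarrow> real \<Rightarrow> real" where
  "speed1 nu u1 u2 u3 =
     deriv (\<lambda>x. frequency nu x u2 u3) u1 / deriv (\<lambda>x. wavenumber nu x u2 u3) u1"

definition speed2 :: "real \<Rightarrow> real \<Rightarrow> real \<Rightarrow> real \<Rightarrow> real" where
  "speed2 nu u1 u2 u3 =
     deriv (\<lambda>x. frequency nu u1 x u3) u2 / deriv (\<lambda>x. wavenumber nu u1 x u3) u2"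

definition speed3 :: "real \<Rightarrow> real \<Rightarrow> real \<Rightarrow> real \<Rightarrow> real" where
  "speed3 nu u1 u2 u3 =
     deriv (\<lambda>x. frequency nu u1 u2 x) u3 / deriv (\<lambda>x. wavenumber nu u1 u2 x) u3"

definition modS :: "real \<Rightarrow> real \<Rightarrow> real \<Rightarrow> real \<Rightarrow> real" where
  "modS nu u1 u2 u3 = sqrt (((u2 - u1) * (u3 + nu)) / ((u3 - u1) * (u2 + nu)))"

definition parRho :: "real \<Rightarrow> real \<Rightarrow> real \<Rightarrow> real" where
  "parRho nu u1 u2 = sqrt ((u2 - u1) / (u2 + nu))"

end

theory Submission
  imports Defs
begin

text \<open>
  Put \<open>a = u\<^sup>1 + \<nu>\<close>, \<open>b = u\<^sup>2 + \<nu>\<close>, \<open>c = u\<^sup>3 + \<nu>\<close>. The substitution \<open>\<lambda> + \<nu> = \<mu> = a + (b - a) sin\<^sup>2 \<theta>\<close> removes the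
  endpoint singularities of the period, \<open>k = \<pi> / J\<close> with \<open>J = \<integral> 2 sqrt (\<mu> / (c - \<mu>)) d\<theta>\<close> over \<open>[0, \<pi>/2]\<close>, so
  \<open>J\<close> can be differentiated under the integral sign and \<open>C\<^sup>i = u\<^sup>1 + u\<^sup>2 + u\<^sup>3 + 2\<nu> - J / \<partial>\<^sub>iJ\<close>. The further substitution
  \<open>tan \<theta> = sqrt (a/b) tan \<psi>\<close> turns \<open>\<mu>\<close> into \<open>a / (1 - \<rho>\<^sup>2 sin\<^sup>2 \<psi>)\<close> and \<open>c - \<mu>\<close> into
  \<open>(c - a) \<Delta>\<^sup>2 / (1 - \<rho>\<^sup>2 sin\<^sup>2 \<psi>)\<close> with \<open>\<Delta>\<^sup>2 = 1 - s\<^sup>2 sin\<^sup>2 \<psi>\<close>. Hence \<open>J\<close> is a multiple of \<open>\<Lambda>\<close>, and the \<open>\<partial>\<^sub>iJ\<close> are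
  integrals of \<open>cos\<^sup>2 \<psi> / \<Delta>\<^sup>3\<close>, \<open>sin\<^sup>2 \<psi> / \<Delta>\<^sup>3\<close>, \<open>1 / \<Delta>\<^sup>3\<close>, which reduce to \<open>K\<close> and \<open>E\<close>.
  Since \<open>1 - s\<^sup>2 = a (c - b) / (b (c - a))\<close>, the speeds are ordered by the signs of \<open>K - E\<close> and \<open>E - (1 - s\<^sup>2) K\<close>, and
  the two limits are \<open>s \<rightarrow> 1\<close> (where \<open>K \<rightarrow> \<infinity>\<close>, \<open>(1 - s\<^sup>2) K \<rightarrow> 0\<close> and \<open>\<Lambda> = K / (1 - \<rho>\<^sup>2) + O(1)\<close>) and \<open>s \<rightarrow> 0\<close>
  (where \<open>K - E\<close> and \<open>E - (1 - s\<^sup>2) K\<close> are both asymptotic to \<open>\<pi> s\<^sup>2 / 4\<close>).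
\<close>

section \<open>Substitution and complete elliptic integrals\<close>

text \<open>The change of variables runs over the open interval because \<open>f\<close> may blow up
  at \<open>c\<close> and \<open>d\<close>, as the integrand of the period does at \<open>u1\<close>
  and \<open>u2\<close>. Continuity up to the endpoints is asked of the transformed integrand
  \<open>h\<close>; the change-of-variables theorem carries absolute integrability back to
  \<open>f\<close>, and the two endpoints form a null set.\<close>

lemma integral_substitution_open_interval:
  fixes f g g' h :: "real \<Rightarrow> real"
  assumes der: "\<And>x. a < x \<Longrightarrow> x < b \<Longrightarrow> (g has_real_derivative g' x) (at x)"
    and pos: "\<And>x. a < x \<Longrightarrow> x < b \<Longrightarrow> 0 < g' x"
    and img: "g ` {a<..<b} = {c<..<d}"
    and cont: "continuous_on {a..b} h"
    and h: "\<And>x. a < x \<Longrightarrow> x < b \<Longrightarrow> h x = g' x * f (g x)"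
  shows "integral {c..d} f = integral {a..b} h"
proof -
  let ?S = "{a<..<b}"
  have less: "g x < g y" if "a < x" "x < y" "y < b" for x y
    using that by (intro DERIV_pos_imp_increasing[of x y g])
      (meson der pos less_le_trans le_less_trans)+
  have inj: "inj_on g ?S"
    by (rule linorder_inj_onI) (use less in fastforce)+
  have "h absolutely_integrable_on {a..b}"
    using cont by (rule absolutely_integrable_continuous_real)
  then have "h absolutely_integrable_on ?S"
    by (rule set_integrable_subset) auto
  moreover have eq: "h x = \<bar>g' x\<bar> * f (g x)" if "x \<in> ?S" for x
    using that pos[of x] h[of x] by auto
  ultimately have ai: "(\<lambda>x. \<bar>g' x\<bar> * f (g x)) absolutely_integrable_on ?S"
    by (subst (asm) set_integrable_cong[OF refl refl eq]) auto
  have "f absolutely_integrable_on (g ` ?S) \<and>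
        integral (g ` ?S) f = integral ?S (\<lambda>x. \<bar>g' x\<bar> * f (g x))"
    by (subst has_absolute_integral_change_of_variables_1'[where S = ?S, symmetric])
       (auto intro: der has_field_derivative_at_within inj ai)
  then have "integral {c<..<d} f = integral ?S (\<lambda>x. \<bar>g' x\<bar> * f (g x))"
    by (simp add: img)
  also have "\<dots> = integral ?S h"
    by (rule integral_cong) (simp add: eq)
  finally show ?thesis
    by (simp add: integral_open_interval_real)
qed

text \<open>The derivative is required to be positive only inside, since sin^2 has critical points
  at both ends of [0, pi/2]. Continuity extends strict monotonicity to the endpoints, and the
  intermediate value theorem gives surjectivity.\<close>

lemma increasing_image_open_interval:
  fixes g g' :: "real \<Rightarrow> real"
  assumes "a < b"
    and cont: "continuous_on {a..b} g"
    and der: "\<And>x. a < x \<Longrightarrow> x < b \<Longrightarrow> (g has_real_derivative g' x) (at x)"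
    and pos: "\<And>x. a < x \<Longrightarrow> x < b \<Longrightarrow> 0 < g' x"
  shows "g ` {a<..<b} = {g a<..<g b}"
proof -
  have less: "g x < g y" if "a \<le> x" "x < y" "y \<le> b" for x y
  proof (rule DERIV_pos_imp_increasing_open[OF \<open>x < y\<close>])
    show "\<exists>l. (g has_real_derivative l) (at z) \<and> 0 < l" if "x < z" "z < y" for z
      using that \<open>a \<le> x\<close> \<open>y \<le> b\<close> der[of z] pos[of z] by auto
    show "continuous_on {x..y} g"
      using that by (auto intro: continuous_on_subset[OF cont])
  qed
  show ?thesis
  proof (intro equalityI subsetI)
    fix y assume y: "y \<in> {g a<..<g b}"
    then obtain x where "a \<le> x" "x \<le> b" "g x = y"
      using IVT'[of g a y b] cont \<open>a < b\<close> by auto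
    then show "y \<in> g ` {a<..<b}"
      using y by (cases "x = a \<or> x = b") auto
  qed (auto intro: less)
qed

section \<open>Legendre's Delta (dn along the amplitude) and the passage from Jacobi's to Legendre's
  form\<close>

definition ellDelta :: "real \<Rightarrow> real \<Rightarrow> real" where
  "ellDelta s \<psi> = sqrt (1 - s^2 * (sin \<psi>)^2)"

lemma ellDelta_arg_ge:
  fixes s \<psi> :: real
  shows "1 - s^2 \<le> 1 - s^2 * (sin \<psi>)^2"
  using mult_left_mono[of "(sin \<psi>)^2" 1 "s^2"] by (simp add: abs_square_le_1)

lemma one_minus_square_pos:
  fixes s :: real
  assumes "0 \<le> s" "s < 1"
  shows "0 < 1 - s^2"
  using assms by (simp add: power_less_one_iff)

lemma ellDelta_pos: "0 \<le> s \<Longrightarrow> s < 1 \<Longrightarrow> 0 < ellDelta s \<psi>"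
  unfolding ellDelta_def using ellDelta_arg_ge[of s \<psi>] one_minus_square_pos[of s] by simp

lemma ellDelta_square: "0 \<le> s \<Longrightarrow> s < 1 \<Longrightarrow> (ellDelta s \<psi>)^2 = 1 - s^2 * (sin \<psi>)^2"
  unfolding ellDelta_def using ellDelta_arg_ge[of s \<psi>] one_minus_square_pos[of s] by simp

lemma ellDelta_ge_sqrt: "sqrt (1 - s^2) \<le> ellDelta s \<psi>"
  unfolding ellDelta_def using ellDelta_arg_ge[of s \<psi>] by simp

lemma ellDelta_le_1: "ellDelta s \<psi> \<le> 1"
  unfolding ellDelta_def by simp

text \<open>Here Delta^2 - cos^2 = (1 - s^2) sin^2. The resulting bound cos / Delta <= 1 is uniform
  in s and controls the integrands near psi = pi/2 when s tends to 1.\<close>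

lemma ellDelta_ge_cos: "0 \<le> s \<Longrightarrow> s < 1 \<Longrightarrow> cos \<psi> \<le> ellDelta s \<psi>"
  unfolding ellDelta_def
  by (rule real_le_rsqrt)
     (use mult_right_mono[of "s^2" 1 "(sin \<psi>)^2"] in \<open>simp add: cos_squared_eq power_le_one\<close>)

lemma continuous_on_ellDelta [continuous_intros]: "continuous_on A (ellDelta s)"
  unfolding ellDelta_def[abs_def] by (intro continuous_intros)

lemma ellDelta_has_derivative:
  assumes "0 \<le> s" "s < 1"
  shows "(ellDelta s has_real_derivative - (s^2 * sin x * cos x / ellDelta s x)) (at x)"
  using ellDelta_pos[OF assms, of x] unfolding ellDelta_def[abs_def]
  by (auto intro!: derivative_eq_intros simp: field_simps)

lemma ellK_eq: "ellK s = integral {0..pi/2} (\<lambda>\<psi>. 1 / ellDelta s \<psi>)"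
  unfolding ellK_def ellDelta_def ..

lemma ellE_eq: "ellE s = integral {0..pi/2} (ellDelta s)"
  unfolding ellE_def ellDelta_def ..

lemma ellF_has_derivative:
  assumes s: "0 \<le> s" "s < 1"
  shows "(ellF s has_real_derivative 1 / ellDelta s x) (at x)"
proof -
  \<comment> \<open>\<open>ellF\<close> is defined by cases at 0. Moving the base point to
    \<open>-N\<close>, left of both 0 and \<open>x\<close>, turns both cases into one integral with
    variable upper limit, up to a constant.\<close>
  define N where "N = \<bar>x\<bar> + 1"
  let ?f = "\<lambda>\<psi>. 1 / ellDelta s \<psi>"
  have cont: "continuous_on A ?f" for A
    using ellDelta_pos[OF s] by (intro continuous_intros) (auto simp: less_le)
  have int: "?f integrable_on {p..q}" for p q
    using cont by (rule integrable_continuous_real)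
  have eq: "ellF s y = integral {-N..y} ?f - integral {-N..0} ?f" if "-N < y" for y
  proof (cases "0 \<le> y")
    case True
    then show ?thesis
      using Henstock_Kurzweil_Integration.integral_combine[of "-N" 0 y ?f] int
      by (auto simp: ellF_def ellDelta_def N_def algebra_simps)
  next
    case False
    then show ?thesis
      using Henstock_Kurzweil_Integration.integral_combine[of "-N" y 0 ?f] int that
      by (simp add: ellF_def ellDelta_def)
  qed
  have "((\<lambda>y. integral {-N..y} ?f) has_real_derivative ?f x) (at x within {-N..N})"
    by (rule integral_has_real_derivative[OF cont]) (auto simp: N_def)
  moreover have "at x within {-N..N} = at x"
    by (rule at_within_interior) (auto simp: N_def)
  ultimately have "((\<lambda>y. integral {-N..y} ?f - integral {-N..0} ?f) has_real_derivative ?f x) (at x)"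
    by (auto intro!: derivative_eq_intros)
  then show ?thesis
    by (rule has_field_derivative_transform_within_open[where S = "{-N<..}"])
       (auto simp: eq N_def)
qed

text \<open>The derivative 1 / Delta is positive, so \<open>ellF s\<close> is strictly increasing
  and the definite description in \<open>jacobi_am\<close> has a unique solution.\<close>

lemma jacobi_am_ellF:
  assumes s: "0 \<le> s" "s < 1"
  shows "jacobi_am s (ellF s x) = x"
proof -
  have "ellF s y < ellF s z" if "y < z" for y z
    using ellF_has_derivative[OF s] ellDelta_pos[OF s]
    by (intro DERIV_pos_imp_increasing[OF that]) (meson zero_less_divide_1_iff)
  then have "y = x" if "ellF s y = ellF s x" for y
    using that by (metis less_irrefl linorder_neqE)
  then show ?thesis
    unfolding jacobi_am_def by (intro the_equality) auto
qed

lemma rho_factor_pos: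
  fixes \<rho> :: real
  assumes "0 \<le> \<rho>" "\<rho> < 1"
  shows "0 < 1 - \<rho>^2 * (sin \<psi>)^2"
  using ellDelta_arg_ge[of \<rho> \<psi>] one_minus_square_pos[OF assms] by simp

lemma continuous_on_ellLambda_integrand:
  assumes s: "0 \<le> s" "s < 1" and \<rho>: "0 \<le> \<rho>" "\<rho> < 1"
  shows "continuous_on A (\<lambda>\<psi>. 1 / ((1 - \<rho>^2 * (sin \<psi>)^2) * ellDelta s \<psi>))"
  using ellDelta_pos[OF s] rho_factor_pos[OF \<rho>]
  by (intro continuous_intros) (auto simp: less_le)

text \<open>Substitute v = F(psi): then am v = psi, sn v = sin psi, dv = dpsi / Delta, and psi =
  pi/2 corresponds to v = K.\<close>

lemma ellLambda_eq:
  assumes s: "0 \<le> s" "s < 1" and \<rho>: "0 \<le> \<rho>" "\<rho> < 1"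
  shows "ellLambda \<rho> s = integral {0..pi/2} (\<lambda>\<psi>. 1 / ((1 - \<rho>^2 * (sin \<psi>)^2) * ellDelta s \<psi>))"
proof -
  have K: "ellF s (pi/2) = ellK s" "ellF s 0 = 0"
    by (auto simp: ellF_def ellK_def)
  have "ellF s ` {0<..<pi/2} = {ellF s 0<..<ellF s (pi/2)}"
    using ellF_has_derivative[OF s] ellDelta_pos[OF s]
    by (intro increasing_image_open_interval[where g' = "\<lambda>x. 1 / ellDelta s x"])
       (auto intro!: DERIV_continuous_on intro: has_field_derivative_at_within)
  then show ?thesis
    unfolding ellLambda_def
    using ellF_has_derivative[OF s] ellDelta_pos[OF s] continuous_on_ellLambda_integrand[OF assms]
    by (intro integral_substitution_open_interval[where g' = "\<lambda>x. 1 / ellDelta s x" and g = "ellF s"])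
       (auto simp: K jacobi_sn_def jacobi_am_ellF[OF s] mult.commute)
qed

text \<open>The function s^2 sin cos / Delta vanishes at 0 and pi/2, and its derivative is Delta -
  (1 - s^2) / Delta^3, so the latter integrates to 0.\<close>

lemma integral_inverse_ellDelta_cube:
  assumes s: "0 \<le> s" "s < 1"
  shows "integral {0..pi/2} (\<lambda>\<psi>. 1 / ellDelta s \<psi> ^ 3) = ellE s / (1 - s^2)"
proof -
  let ?D = "ellDelta s"
  have D: "?D x > 0" "?D x \<noteq> 0" for x
    using ellDelta_pos[OF s, of x] by auto
  have "((\<lambda>x. s^2 * (sin x * cos x / ?D x)) has_real_derivative ?D x - (1 - s^2) / ?D x ^ 3) (at x)" for x
  proof -
    have "((\<lambda>x. s^2 * (sin x * cos x / ?D x)) has_real_derivative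
      s^2 * (((cos x * cos x - sin x * sin x) * ?D x + sin x * cos x * (s^2 * sin x * cos x / ?D x)) / (?D x * ?D x))) (at x)"
      using D by (auto intro!: derivative_eq_intros ellDelta_has_derivative[OF s] simp: algebra_simps)
    moreover have "s^2 * (((cos x * cos x - sin x * sin x) * ?D x + sin x * cos x * (s^2 * sin x * cos x / ?D x)) / (?D x * ?D x))
      = s^2 * ((cos x ^ 2 - sin x ^ 2) * ?D x ^ 2 + s^2 * sin x ^ 2 * cos x ^ 2) / ?D x ^ 3"
      using D[of x] by (simp add: field_simps power2_eq_square power3_eq_cube)
    moreover have "\<dots> = ((?D x ^ 2)^2 - (1 - s^2)) / ?D x ^ 3"
      unfolding ellDelta_square[OF s] cos_squared_eq by (rule arg_cong[where f = "\<lambda>z. z / _"]) algebra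
    moreover have "\<dots> = ?D x - (1 - s^2) / ?D x ^ 3"
      using D[of x] by (simp add: field_simps power2_eq_square power3_eq_cube)
    ultimately show ?thesis by simp
  qed
  then have "((\<lambda>x. ?D x - (1 - s^2) / ?D x ^ 3) has_integral
      s^2 * (sin (pi/2) * cos (pi/2) / ?D (pi/2)) - s^2 * (sin 0 * cos 0 / ?D 0)) {0..pi/2}"
    by (intro fundamental_theorem_of_calculus)
       (auto simp: has_real_derivative_iff_has_vector_derivative[symmetric] intro: has_field_derivative_at_within)
  then have "integral {0..pi/2} (\<lambda>x. ?D x - (1 - s^2) / ?D x ^ 3) = 0"
    by (auto dest: integral_unique)
  moreover have "integral {0..pi/2} (\<lambda>x. ?D x - (1 - s^2) * (1 / ?D x ^ 3)) =
     ellE s - (1 - s^2) * integral {0..pi/2} (\<lambda>x. 1 / ?D x ^ 3)"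
    unfolding ellE_eq integral_mult_right[symmetric] using D
    by (intro integral_diff integrable_continuous_real continuous_intros) auto
  ultimately show ?thesis
    using one_minus_square_pos[OF s] by (simp add: field_simps)
qed

text \<open>The identity s^2 sin^2 = 1 - Delta^2 splits sin^2 / Delta^3 into multiples of Delta^-3
  and Delta^-1; the cosine integral then follows from cos^2 = 1 - sin^2.\<close>

lemma ellDelta_integrals:
  assumes s: "0 < s" "s < 1"
  shows "integral {0..pi/2} (\<lambda>\<psi>. (sin \<psi>)^2 / ellDelta s \<psi> ^ 3) = (ellE s / (1 - s^2) - ellK s) / s^2"
    and "integral {0..pi/2} (\<lambda>\<psi>. (cos \<psi>)^2 / ellDelta s \<psi> ^ 3) = (ellK s - ellE s) / s^2"
proof -
  let ?D = "ellDelta s"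
  have s': "0 \<le> s" "s < 1" using s by auto
  have D: "?D x > 0" "?D x \<noteq> 0" for x
    using ellDelta_pos[OF s', of x] by auto
  have i: "(\<lambda>x. 1 / ?D x ^ 3) integrable_on {0..pi/2}" "(\<lambda>x. 1 / ?D x) integrable_on {0..pi/2}"
     "(\<lambda>x. (sin x)^2 / ?D x ^ 3) integrable_on {0..pi/2}"
    using D by (auto intro!: integrable_continuous_real continuous_intros)
  have "(sin x)^2 / ?D x ^ 3 = (1 / ?D x ^ 3 - 1 / ?D x) / s^2" for x
  proof -
    have "(1 / ?D x ^ 3 - 1 / ?D x) = (1 - ?D x ^ 2) / ?D x ^ 3"
      using D[of x] by (simp add: field_simps power2_eq_square power3_eq_cube)
    then show ?thesis using s by (simp add: ellDelta_square[OF s'])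
  qed
  then have "integral {0..pi/2} (\<lambda>\<psi>. (sin \<psi>)^2 / ?D \<psi> ^ 3) =
     integral {0..pi/2} (\<lambda>\<psi>. (1 / ?D \<psi> ^ 3 - 1 / ?D \<psi>) / s^2)"
    by simp
  also have "\<dots> = (ellE s / (1 - s^2) - ellK s) / s^2"
    using i by (simp add: integral_diff integral_inverse_ellDelta_cube[OF s'] ellK_eq)
  finally show *: "integral {0..pi/2} (\<lambda>\<psi>. (sin \<psi>)^2 / ?D \<psi> ^ 3) = (ellE s / (1 - s^2) - ellK s) / s^2" .
  \<comment> \<open>Applied with x = E / (1 - s^2), for which (1 - s^2) x collapses to E.\<close>
  have X: "x - (x - ellK s) / s^2 = (ellK s - (1 - s^2) * x) / s^2" for x
    using s by (simp add: field_simps)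
  have "integral {0..pi/2} (\<lambda>\<psi>. (cos \<psi>)^2 / ?D \<psi> ^ 3) =
     integral {0..pi/2} (\<lambda>\<psi>. 1 / ?D \<psi> ^ 3 - (sin \<psi>)^2 / ?D \<psi> ^ 3)"
    by (simp add: cos_squared_eq diff_divide_distrib)
  also have "\<dots> = ellE s / (1 - s^2) - (ellE s / (1 - s^2) - ellK s) / s^2"
    using i by (simp add: integral_diff integral_inverse_ellDelta_cube[OF s'] *)
  also have "\<dots> = (ellK s - (1 - s^2) * (ellE s / (1 - s^2))) / s^2"
    by (rule X)
  also have "(1 - s^2) * (ellE s / (1 - s^2)) = ellE s"
    using one_minus_square_pos[OF s'] by simp
  finally show "integral {0..pi/2} (\<lambda>\<psi>. (cos \<psi>)^2 / ?D \<psi> ^ 3) = (ellK s - ellE s) / s^2" .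
qed

section \<open>The phase integral\<close>

text \<open>The map arctan(r tan x) is an increasing bijection of (0, pi/2), inverted by the same
  map with 1/r. Although tan is infinite at pi/2, the Jacobian r / (cos^2 + r^2 sin^2) is regular on
  the closed interval.\<close>

lemma integral_tan_scaling:
  fixes f h :: "real \<Rightarrow> real"
  assumes r: "0 < r"
    and cont: "continuous_on {0..pi/2} h"
    and h: "\<And>x. 0 < x \<Longrightarrow> x < pi/2 \<Longrightarrow>
      h x = r / ((cos x)^2 + r^2 * (sin x)^2) * f (arctan (r * tan x))"
  shows "integral {0..pi/2} f = integral {0..pi/2} h"
proof -
  let ?g = "\<lambda>x. arctan (r * tan x)" and ?g' = "\<lambda>x. r / ((cos x)^2 + r^2 * (sin x)^2)"
  have pos: "0 < (cos x)^2 + r^2 * (sin x)^2" for x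
    using r by (cases "sin x = 0") (auto simp: add_nonneg_pos dest: sin_zero_norm_cos_one)
  have der: "(?g has_real_derivative ?g' x) (at x)" if "0 < x" "x < pi/2" for x
  proof -
    have c: "cos x > 0" using that by (intro cos_gt_zero_pi) auto
    have "(?g has_real_derivative inverse (1 + (r * tan x)^2) * (r * inverse ((cos x)^2))) (at x)"
      using c by (intro DERIV_chain2[OF DERIV_arctan] DERIV_cmult DERIV_tan) auto
    moreover have "inverse (1 + (r * tan x)^2) * (r * inverse ((cos x)^2)) = ?g' x"
      using c pos[of x] by (simp add: tan_def field_simps)
    ultimately show ?thesis by simp
  qed
  have "?g ` {0<..<pi/2} = {0<..<pi/2}"
  proof (intro equalityI subsetI)
    fix y assume "y \<in> {0<..<pi/2}"
    then have y: "0 < y" "y < pi/2" by auto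
    then have "tan y > 0" by (rule tan_gt_zero)
    then have "arctan (tan y / r) \<in> {0<..<pi/2}" "?g (arctan (tan y / r)) = y"
      using r y arctan_ubound[of "tan y / r"] by (auto simp: arctan_tan tan_arctan)
    then show "y \<in> ?g ` {0<..<pi/2}" by (metis image_eqI)
  next
    fix y assume "y \<in> ?g ` {0<..<pi/2}"
    then obtain x where "0 < x" "x < pi/2" "y = ?g x" by auto
    then show "y \<in> {0<..<pi/2}"
      using r arctan_ubound[of "r * tan x"] tan_gt_zero[of x] by auto
  qed
  then show ?thesis
    using der pos r cont h by (intro integral_substitution_open_interval[where g' = ?g' and g = ?g]) auto
qed

lemma sin_arctan_tan_scaling_squared:
  assumes "0 < x" "x < pi/2"
  shows "(sin (arctan (r * tan x)))^2 = r^2 * (sin x)^2 / ((cos x)^2 + r^2 * (sin x)^2)"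
    and "(cos (arctan (r * tan x)))^2 = (cos x)^2 / ((cos x)^2 + r^2 * (sin x)^2)"
proof -
  have c: "cos x > 0" using assms by (intro cos_gt_zero_pi) auto
  have d: "1 + (r * tan x)^2 = ((cos x)^2 + r^2 * (sin x)^2) / (cos x)^2"
    using c by (simp add: tan_def field_simps)
  show "(sin (arctan (r * tan x)))^2 = r^2 * (sin x)^2 / ((cos x)^2 + r^2 * (sin x)^2)"
    unfolding sin_arctan power_divide real_sqrt_pow2[OF add_nonneg_nonneg[OF zero_le_one zero_le_power2]] d
    using c by (simp add: tan_def power_divide power_mult_distrib)
  show "(cos (arctan (r * tan x)))^2 = (cos x)^2 / ((cos x)^2 + r^2 * (sin x)^2)"
    unfolding cos_arctan power_divide real_sqrt_pow2[OF add_nonneg_nonneg[OF zero_le_one zero_le_power2]] d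
    using c by (simp add: tan_def)
qed

section \<open>The moduli in terms of a, b, c: nu enters only through the shifts u + nu\<close>

lemma modS_shift: "modS nu u1 u2 u3 = modS 0 (u1 + nu) (u2 + nu) (u3 + nu)"
  by (simp add: modS_def)

lemma parRho_shift: "parRho nu u1 u2 = parRho 0 (u1 + nu) (u2 + nu)"
  by (simp add: parRho_def)

lemma modS_props:
  fixes a b c :: real
  assumes "0 < a" "a < b" "b < c"
  shows "(modS 0 a b c)^2 = (b - a) * c / ((c - a) * b)"
    and "1 - (modS 0 a b c)^2 = a * (c - b) / (b * (c - a))"
    and "0 < modS 0 a b c" and "modS 0 a b c < 1"
proof -
  \<comment> \<open>This is b (c - a) - c (b - a) = a (c - b); the positivity of the right-hand side
    puts s below 1.\<close>
  have *: "1 - (b - a) * c / ((c - a) * b) = a * (c - b) / (b * (c - a))"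
    using assms by (simp add: field_simps)
  show 1: "(modS 0 a b c)^2 = (b - a) * c / ((c - a) * b)"
    using assms by (simp add: modS_def)
  show 2: "1 - (modS 0 a b c)^2 = a * (c - b) / (b * (c - a))"
    unfolding 1 by (rule *)
  show "0 < modS 0 a b c"
    using assms by (simp add: modS_def)
  have "0 < a * (c - b) / (b * (c - a))" using assms by simp
  then show "modS 0 a b c < 1"
    using * by (simp add: modS_def)
qed

lemma parRho_props:
  fixes a b :: real
  assumes "0 < a" "a < b"
  shows "(parRho 0 a b)^2 = (b - a) / b"
    and "1 - (parRho 0 a b)^2 = a / b"
    and "0 < parRho 0 a b" and "parRho 0 a b < 1"
  using assms by (auto simp: parRho_def field_simps)

section \<open>The phase integral J = pi / k and its derivatives in a, b, c\<close>

definition phaseMu :: "real \<Rightarrow> real \<Rightarrow> real \<Rightarrow> real" where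
  "phaseMu a b \<theta> = a + (b - a) * (sin \<theta>)^2"

text \<open>The domain of integration is fixed and the integrand is smooth in theta and in a, b, c
  as long as 0 < a <= mu <= b < c. In the variable lambda, by contrast, the singular endpoints move
  with the parameters.\<close>

definition phaseJ :: "real \<Rightarrow> real \<Rightarrow> real \<Rightarrow> real" where
  "phaseJ a b c = integral {0..pi/2} (\<lambda>\<theta>. 2 * sqrt (phaseMu a b \<theta> / (c - phaseMu a b \<theta>)))"

lemma phaseMu_bounds:
  assumes "a < b"
  shows "a \<le> phaseMu a b \<theta>" "phaseMu a b \<theta> \<le> b"
proof -
  have "(sin \<theta>)^2 \<le> 1" by (simp add: abs_square_le_1)
  with assms have "(b - a) * (sin \<theta>)^2 \<le> (b - a) * 1" by (intro mult_left_mono) auto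
  then show "phaseMu a b \<theta> \<le> b" by (simp add: phaseMu_def)
qed (use assms in \<open>simp add: phaseMu_def\<close>)

lemma continuous_on_phaseMu [continuous_intros]:
  fixes f g h :: "'a::t2_space \<Rightarrow> real"
  assumes "continuous_on A f" "continuous_on A g" "continuous_on A h"
  shows "continuous_on A (\<lambda>x. phaseMu (f x) (g x) (h x))"
  unfolding phaseMu_def using assms by (intro continuous_intros)

lemma phaseJ_integrand_continuous:
  assumes "0 < a" "a < b" "b < c"
  shows "continuous_on A (\<lambda>\<theta>. 2 * sqrt (phaseMu a b \<theta> / (c - phaseMu a b \<theta>)))"
  using phaseMu_bounds[of a b] assms
  by (intro continuous_intros ballI) (smt (verit))

text \<open>For lambda = u1 + (u2 - u1) sin^2 x one has (lambda - u1)(u2 - lambda) = (g'/2)^2, so g'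
  cancels the zeros of the root at both ends. The negative signs of lambda - u2 and lambda - u3
  compensate each other.\<close>

lemma wavenumber_eq_phaseJ:
  assumes h: "- nu < u1" "u1 < u2" "u2 < u3"
  shows "wavenumber nu u1 u2 u3 = pi / phaseJ (u1 + nu) (u2 + nu) (u3 + nu)"
proof -
  let ?m = "phaseMu (u1 + nu) (u2 + nu)" and ?c = "u3 + nu"
  let ?g = "\<lambda>x. u1 + (u2 - u1) * (sin x)^2" and ?g' = "\<lambda>x. 2 * (u2 - u1) * (sin x * cos x)"
  have der: "(?g has_real_derivative ?g' x) (at x)" for x
    by (auto intro!: derivative_eq_intros)
  have pos: "0 < ?g' x" if "0 < x" "x < pi/2" for x
    using that h sin_gt_zero[of x] cos_gt_zero_pi[of x] by simp
  have eq: "2 * sqrt (?m x / (?c - ?m x)) = ?g' x * ((?g x + nu) / sqrt (Rpoly nu u1 u2 u3 (?g x)))"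
    if x: "0 < x" "x < pi/2" for x
  proof -
    have m: "0 < ?m x" "?m x < ?c"
      using phaseMu_bounds[of "u1 + nu" "u2 + nu" x] h by auto
    have mg: "?g x + nu = ?m x" "?g x - u3 = - (?c - ?m x)"
      "?g x - u1 = (u2 - u1) * (sin x)^2" "?g x - u2 = - ((u2 - u1) * (cos x)^2)"
      by (auto simp: phaseMu_def cos_squared_eq algebra_simps)
    have sq: "m * (w * p^2) * (- (w * q^2)) * (- d) = (2 * w * (p * q) / 2)^2 * (m * d)" for m w p q d :: real
      by (simp add: power2_eq_square algebra_simps)
    have "Rpoly nu u1 u2 u3 (?g x) = (?g' x / 2)^2 * (?m x * (?c - ?m x))"
      unfolding Rpoly_def mg by (rule sq)
    then have "sqrt (Rpoly nu u1 u2 u3 (?g x)) = ?g' x / 2 * sqrt (?m x * (?c - ?m x))"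
      using pos[OF x] by (simp add: real_sqrt_mult real_sqrt_unique)
    moreover have "?m x / sqrt (?m x * (?c - ?m x)) = sqrt (?m x / (?c - ?m x))"
      using m by (simp add: real_sqrt_mult real_sqrt_divide divide_divide_eq_left[symmetric] real_div_sqrt
                       del: divide_divide_eq_left)
    moreover have "z * (m / (z / 2 * w)) = 2 * (m / w)" if "0 < z" for z m w :: real
      using that by simp
    ultimately show ?thesis
      using pos[OF x] unfolding mg by metis
  qed
  have "?g ` {0<..<pi/2} = {?g 0<..<?g (pi/2)}"
    using pos der by (intro increasing_image_open_interval[where g' = ?g'] continuous_intros) auto
  then have "integral {u1..u2} (\<lambda>l. (l + nu) / sqrt (Rpoly nu u1 u2 u3 l)) =
      phaseJ (u1 + nu) (u2 + nu) (u3 + nu)"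
    unfolding phaseJ_def using der pos eq h
    by (intro integral_substitution_open_interval[where g = ?g and g' = ?g'] phaseJ_integrand_continuous) auto
  then show ?thesis by (simp add: wavenumber_def)
qed

lemma phase_integrand_derivative:
  fixes m c :: real
  assumes "0 < m" "m < c"
  shows "((\<lambda>m. 2 * sqrt (m / (c - m))) has_real_derivative c / (sqrt m * ((c - m) * sqrt (c - m)))) (at m)"
    and "((\<lambda>c. 2 * sqrt (m / (c - m))) has_real_derivative - (sqrt m / ((c - m) * sqrt (c - m)))) (at c)"
proof -
  have q: "0 < m / (c - m)" using assms by simp
  have i: "inverse (sqrt (m / (c - m))) = sqrt (c - m) / sqrt m"
    by (simp add: real_sqrt_divide)
  \<comment> \<open>The square is split into c - m times two roots so that one of them cancels
    against the root from the chain rule; \<open>real_sqrt_mult_self\<close> is removed from the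
    simplifier below because it would merge the roots again.\<close>
  have sq: "(c - m)^2 = (c - m) * (sqrt (c - m) * sqrt (c - m))" "sqrt m \<noteq> 0" "sqrt (c - m) \<noteq> 0"
    using assms by (auto simp: power2_eq_square)
  have "((\<lambda>m. m / (c - m)) has_real_derivative c / (c - m)^2) (at m)"
    using assms by (auto intro!: derivative_eq_intros simp: power2_eq_square algebra_simps)
  from DERIV_chain2[OF DERIV_real_sqrt[OF q] this]
  have "((\<lambda>m. 2 * sqrt (m / (c - m))) has_real_derivative 2 * (sqrt (c - m) / sqrt m / 2 * (c / (c - m)^2))) (at m)"
    unfolding i by (rule DERIV_cmult)
  moreover have "2 * (sqrt (c - m) / sqrt m / 2 * (c / (c - m)^2)) = c / (sqrt m * ((c - m) * sqrt (c - m)))"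
    unfolding sq(1) using sq(2,3) by (simp del: real_sqrt_mult_self real_sqrt_abs2)
  ultimately show "((\<lambda>m. 2 * sqrt (m / (c - m))) has_real_derivative c / (sqrt m * ((c - m) * sqrt (c - m)))) (at m)"
    by simp
  have m: "m / z = sqrt m * sqrt m / z" for z
    using assms by simp
  have "((\<lambda>c. m / (c - m)) has_real_derivative - (m / (c - m)^2)) (at c)"
    using assms by (auto intro!: derivative_eq_intros simp: power2_eq_square)
  from DERIV_chain2[OF DERIV_real_sqrt[OF q] this]
  have "((\<lambda>c. 2 * sqrt (m / (c - m))) has_real_derivative 2 * (sqrt (c - m) / sqrt m / 2 * - (m / (c - m)^2))) (at c)"
    unfolding i by (rule DERIV_cmult)
  moreover have "2 * (sqrt (c - m) / sqrt m / 2 * - (m / (c - m)^2)) = - (sqrt m / ((c - m) * sqrt (c - m)))"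
    unfolding sq(1) m[of "(c - m) * (sqrt (c - m) * sqrt (c - m))"]
    using sq(2,3) by (simp del: real_sqrt_mult_self real_sqrt_abs2)
  ultimately show "((\<lambda>c. 2 * sqrt (m / (c - m))) has_real_derivative - (sqrt m / ((c - m) * sqrt (c - m)))) (at c)"
    by simp
qed

text \<open>This is mu^(1/2) (c - mu)^(3/2), the common denominator of the integrands of all three
  partial derivatives of J.\<close>

abbreviation phaseW :: "real \<Rightarrow> real \<Rightarrow> real \<Rightarrow> real \<Rightarrow> real" where
  "phaseW a b c \<theta> \<equiv> sqrt (phaseMu a b \<theta>) * ((c - phaseMu a b \<theta>) * sqrt (c - phaseMu a b \<theta>))"

text \<open>Leibniz's rule is applied on open parameter sets that preserve 0 < a < b < c. The chain
  rule contributes dmu/da = cos^2 and dmu/db = sin^2, while mu is constant in c.\<close>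

lemma phaseJ_derivatives:
  assumes abc: "0 < a" "a < b" "b < c"
  shows "((\<lambda>x. phaseJ x b c) has_real_derivative integral {0..pi/2} (\<lambda>\<theta>. c * (cos \<theta>)^2 / phaseW a b c \<theta>)) (at a)"
    and "((\<lambda>x. phaseJ a x c) has_real_derivative integral {0..pi/2} (\<lambda>\<theta>. c * (sin \<theta>)^2 / phaseW a b c \<theta>)) (at b)"
    and "((\<lambda>x. phaseJ a b x) has_real_derivative integral {0..pi/2} (\<lambda>\<theta>. - (phaseMu a b \<theta> / phaseW a b c \<theta>))) (at c)"
proof -
  have mu: "0 < phaseMu p q t" "phaseMu p q t < r" if "0 < p" "p < q" "q < r" for p q r t
    using phaseMu_bounds[of p q t] that by auto
  have nz: "phaseW p q r t \<noteq> 0" if "0 < p" "p < q" "q < r" for p q r t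
    using mu[OF that, of t] by simp
  have muD1: "((\<lambda>x. phaseMu x q t) has_real_derivative (cos t)^2) (at p)" for p q t
    unfolding phaseMu_def by (auto intro!: derivative_eq_intros simp: cos_squared_eq)
  have muD2: "((\<lambda>x. phaseMu p x t) has_real_derivative (sin t)^2) (at q)" for p q t
    unfolding phaseMu_def by (auto intro!: derivative_eq_intros)
  have "((\<lambda>x. phaseJ x b c) has_real_derivative integral {0..pi/2} (\<lambda>\<theta>. c * (cos \<theta>)^2 / phaseW a b c \<theta>))
          (at a within {0<..<b})"
    unfolding phaseJ_def cbox_interval[symmetric]
  proof (rule leibniz_rule_field_derivative[where U = "{0<..<b}"])
    fix x t assume "x \<in> {0<..<b}"
    then show "((\<lambda>x. 2 * sqrt (phaseMu x b t / (c - phaseMu x b t))) has_real_derivative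
        c * (cos t)^2 / phaseW x b c t) (at x within {0<..<b})"
      using DERIV_chain2[OF phase_integrand_derivative(1)[OF mu[of x b c]] muD1, of t] abc
      by (auto intro: has_field_derivative_at_within)
  next
    show "continuous_on ({0<..<b} \<times> cbox 0 (pi/2)) (\<lambda>(x, t). c * (cos t)^2 / phaseW x b c t)"
      unfolding split_beta
      by (intro continuous_intros ballI nz) (use abc in auto)
  next
    fix x assume "x \<in> {0<..<b}"
    then show "(\<lambda>t. 2 * sqrt (phaseMu x b t / (c - phaseMu x b t))) integrable_on cbox 0 (pi/2)"
      unfolding cbox_interval using abc
      by (intro integrable_continuous_real phaseJ_integrand_continuous) auto
  qed (use abc in auto)
  then show "((\<lambda>x. phaseJ x b c) has_real_derivative integral {0..pi/2} (\<lambda>\<theta>. c * (cos \<theta>)^2 / phaseW a b c \<theta>)) (at a)"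
    using abc by (subst (asm) at_within_open) auto
  have "((\<lambda>x. phaseJ a x c) has_real_derivative integral {0..pi/2} (\<lambda>\<theta>. c * (sin \<theta>)^2 / phaseW a b c \<theta>))
          (at b within {a<..<c})"
    unfolding phaseJ_def cbox_interval[symmetric]
  proof (rule leibniz_rule_field_derivative[where U = "{a<..<c}"])
    fix x t assume "x \<in> {a<..<c}"
    then show "((\<lambda>x. 2 * sqrt (phaseMu a x t / (c - phaseMu a x t))) has_real_derivative
        c * (sin t)^2 / phaseW a x c t) (at x within {a<..<c})"
      using DERIV_chain2[OF phase_integrand_derivative(1)[OF mu[of a x c]] muD2, of t] abc
      by (auto intro: has_field_derivative_at_within)
  next
    show "continuous_on ({a<..<c} \<times> cbox 0 (pi/2)) (\<lambda>(x, t). c * (sin t)^2 / phaseW a x c t)"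
      unfolding split_beta
      by (intro continuous_intros ballI nz) (use abc in auto)
  next
    fix x assume "x \<in> {a<..<c}"
    then show "(\<lambda>t. 2 * sqrt (phaseMu a x t / (c - phaseMu a x t))) integrable_on cbox 0 (pi/2)"
      unfolding cbox_interval using abc
      by (intro integrable_continuous_real phaseJ_integrand_continuous) auto
  qed (use abc in auto)
  then show "((\<lambda>x. phaseJ a x c) has_real_derivative integral {0..pi/2} (\<lambda>\<theta>. c * (sin \<theta>)^2 / phaseW a b c \<theta>)) (at b)"
    using abc by (subst (asm) at_within_open) auto
  have "((\<lambda>x. phaseJ a b x) has_real_derivative integral {0..pi/2} (\<lambda>\<theta>. - (phaseMu a b \<theta> / phaseW a b c \<theta>)))
          (at c within {b<..})"
    unfolding phaseJ_def cbox_interval[symmetric]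
  proof (rule leibniz_rule_field_derivative[where U = "{b<..}"])
    fix x t assume x: "x \<in> {b<..}"
    \<comment> \<open>Writing mu^(1/2) / (c - mu)^(3/2) as mu / W gives the derivative in c the same
      denominator as the other two.\<close>
    have "phaseMu a b t / phaseW a b x t = sqrt (phaseMu a b t) / ((x - phaseMu a b t) * sqrt (x - phaseMu a b t))"
      using mu[of a b x t] abc x 
      by (simp add: real_div_sqrt divide_divide_eq_left[symmetric] del: divide_divide_eq_left)
    then show "((\<lambda>x. 2 * sqrt (phaseMu a b t / (x - phaseMu a b t))) has_real_derivative
        - (phaseMu a b t / phaseW a b x t)) (at x within {b<..})"
      using phase_integrand_derivative(2)[OF mu[of a b x]] abc x
      by (auto intro: has_field_derivative_at_within)
  next
    show "continuous_on ({b<..} \<times> cbox 0 (pi/2)) (\<lambda>(x, t). - (phaseMu a b t / phaseW a b x t))"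
      unfolding split_beta
      by (intro continuous_intros ballI nz) (use abc in auto)
  next
    fix x assume "x \<in> {b<..}"
    then show "(\<lambda>t. 2 * sqrt (phaseMu a b t / (x - phaseMu a b t))) integrable_on cbox 0 (pi/2)"
      unfolding cbox_interval using abc
      by (intro integrable_continuous_real phaseJ_integrand_continuous) auto
  qed (use abc in auto)
  then show "((\<lambda>x. phaseJ a b x) has_real_derivative integral {0..pi/2} (\<lambda>\<theta>. - (phaseMu a b \<theta> / phaseW a b c \<theta>))) (at c)"
    using abc by (subst (asm) at_within_open) auto
qed

text \<open>In t = sin^2 psi the substitution is the Moebius map mu = a / (1 - rho^2 t). It sends t
  = 0, 1, 1/s^2, infinity to mu = a, b, c, 0, which puts the four branch points into Legendre's
  normal position; \<open>P\<close> is the factor of its pole.\<close>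

lemma phaseMu_tan_scaling:
  assumes abc: "0 < a" "a < b" "b < c" and x: "0 < x" "x < pi/2"
  defines "\<theta> \<equiv> arctan (sqrt (a/b) * tan x)" and "P \<equiv> 1 - (parRho 0 a b)^2 * (sin x)^2"
  shows "(cos x)^2 + (sqrt (a/b))^2 * (sin x)^2 = P" and "0 < P"
    and "phaseMu a b \<theta> = a / P"
    and "c - phaseMu a b \<theta> = (c - a) * (ellDelta (modS 0 a b c) x)^2 / P"
    and "(sin \<theta>)^2 = a / b * (sin x)^2 / P"
    and "(cos \<theta>)^2 = (cos x)^2 / P"
    and "phaseW a b c \<theta> = sqrt a * ((c - a) * sqrt (c - a)) * ellDelta (modS 0 a b c) x ^ 3 / P^2"
proof -
  note \<rho> = parRho_props[OF abc(1,2)] and s = modS_props[OF abc]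
  let ?D = "ellDelta (modS 0 a b c) x"
  have r2: "(sqrt (a/b))^2 = a / b" using abc by simp
  have PP: "b * P = b * (cos x)^2 + a * (sin x)^2"
    unfolding P_def \<rho>(1) cos_squared_eq using abc by (simp add: field_simps)
  then have "P = (b * (cos x)^2 + a * (sin x)^2) / b"
    using abc by (simp add: nonzero_eq_divide_eq mult.commute)
  then show P1: "(cos x)^2 + (sqrt (a/b))^2 * (sin x)^2 = P"
    unfolding r2 using abc by (simp add: add_divide_distrib)
  show P: "0 < P"
    unfolding P_def using \<rho> by (intro rho_factor_pos) auto
  show sn: "(sin \<theta>)^2 = a / b * (sin x)^2 / P"
    unfolding \<theta>_def sin_arctan_tan_scaling_squared[OF x] r2 P1[unfolded r2] by simp
  show "(cos \<theta>)^2 = (cos x)^2 / P"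
    unfolding \<theta>_def sin_arctan_tan_scaling_squared[OF x] r2 P1[unfolded r2] by simp
  have Pb: "P * b = b - (b - a) * (sin x)^2"
    unfolding P_def \<rho>(1) using abc by (simp add: field_simps)
  show mu: "phaseMu a b \<theta> = a / P"
  proof -
    have "phaseMu a b \<theta> * (P * b) = a * (P * b) + (b - a) * (a * (sin x)^2)"
      unfolding phaseMu_def sn using abc P by (simp add: field_simps)
    also have "\<dots> = a * b" unfolding Pb by algebra
    finally show ?thesis using abc P by (simp add: field_simps)
  qed
  have D: "?D > 0" "?D^2 = 1 - (modS 0 a b c)^2 * (sin x)^2"
    using s by (auto intro: ellDelta_pos simp: ellDelta_square)
  show cm: "c - phaseMu a b \<theta> = (c - a) * ?D^2 / P"
  proof -
    have "(c - a) * ?D^2 * b = (c - a) * b - (b - a) * c * (sin x)^2"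
      unfolding D s(1) using abc by (simp add: field_simps)
    also have "\<dots> = c * (P * b) - a * b" unfolding Pb by algebra
    finally have "((c - a) * ?D^2 - (c * P - a)) * b = 0"
      by (simp add: left_diff_distrib mult.assoc)
    then have "(c - a) * ?D^2 = c * P - a" using abc by simp
    then show ?thesis unfolding mu using P by (simp add: field_simps)
  qed
  have "sqrt (c - phaseMu a b \<theta>) = sqrt (c - a) * ?D / sqrt P"
    unfolding cm using D(1) by (simp add: real_sqrt_mult real_sqrt_divide)
  moreover have "sqrt (phaseMu a b \<theta>) = sqrt a / sqrt P"
    unfolding mu by (simp add: real_sqrt_divide)
  ultimately have "phaseW a b c \<theta> = sqrt a / sqrt P * ((c - a) * ?D^2 / P * (sqrt (c - a) * ?D / sqrt P))"
    unfolding cm by simp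
  also have "\<dots> = sqrt a * ((c - a) * sqrt (c - a)) * ?D ^ 3 / (P * (sqrt P * sqrt P))"
    by (simp add: power2_eq_square power3_eq_cube mult_ac del: real_sqrt_mult_self real_sqrt_abs2)
  finally show "phaseW a b c \<theta> = sqrt a * ((c - a) * sqrt (c - a)) * ?D ^ 3 / P^2"
    using P by (simp add: power2_eq_square)
qed

text \<open>The factor \<open>P\<close> cancels in mu / (c - mu), and the Jacobian is sqrt(a/b) /
  \<open>P\<close>. Exactly one 1/\<open>P\<close> survives beside 1/Delta, which is the integrand
  of the third kind.\<close>

lemma phaseJ_eq_ellLambda:
  assumes abc: "0 < a" "a < b" "b < c"
  shows "phaseJ a b c = 2 * a * ellLambda (parRho 0 a b) (modS 0 a b c) / (sqrt b * sqrt (c - a))"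
proof -
  note \<rho> = parRho_props[OF abc(1,2)] and s = modS_props[OF abc] and t = phaseMu_tan_scaling[OF abc]
  let ?P = "\<lambda>x. 1 - (parRho 0 a b)^2 * (sin x)^2" and ?D = "ellDelta (modS 0 a b c)"
  let ?C = "2 * a / (sqrt b * sqrt (c - a))"
  have "phaseJ a b c = integral {0..pi/2} (\<lambda>x. ?C * (1 / (?P x * ?D x)))"
    unfolding phaseJ_def
  proof (rule integral_tan_scaling[where r = "sqrt (a/b)"])
    show "continuous_on {0..pi/2} (\<lambda>x. ?C * (1 / (?P x * ?D x)))"
      using s \<rho> by (intro continuous_on_mult continuous_on_const continuous_on_ellLambda_integrand) auto
    fix x :: real assume x: "0 < x" "x < pi/2"
    have aa: "sqrt a * (2 * sqrt a) = 2 * a" using abc by simp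
    have D: "?D x > 0" using s by (intro ellDelta_pos) auto
    have P: "?P x > 0" by (rule t(2)[OF x])
    let ?m = "phaseMu a b (arctan (sqrt (a/b) * tan x))"
    have "sqrt (?m / (c - ?m)) = sqrt (a / ?P x / ((c - a) * (?D x)^2 / ?P x))"
      unfolding t(4)[OF x] unfolding t(3)[OF x] ..
    also have "\<dots> = sqrt (a / ((c - a) * (?D x)^2))"
      using P by simp
    also have "\<dots> = sqrt a / (sqrt (c - a) * ?D x)"
      using D by (simp add: real_sqrt_divide real_sqrt_mult)
    finally have "sqrt (?m / (c - ?m)) = sqrt a / (sqrt (c - a) * ?D x)" .
    then show "?C * (1 / (?P x * ?D x)) = sqrt (a/b) / ((cos x)^2 + (sqrt (a/b))^2 * (sin x)^2) * (2 * sqrt (?m / (c - ?m)))"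
      unfolding t(1)[OF x] using aa by (simp add: real_sqrt_divide, simp add: mult_ac)
  qed (use abc in auto)
  also have "\<dots> = ?C * ellLambda (parRho 0 a b) (modS 0 a b c)"
    unfolding integral_mult_right using s \<rho> by (subst ellLambda_eq) auto
  finally show ?thesis by simp
qed

text \<open>The Jacobian and each numerator (cos^2, sin^2 or mu) contribute one factor
  1/\<open>P\<close>, and 1/W contributes \<open>P\<close>^2. All powers of \<open>P\<close> cancel
  and only Delta^-3 remains, so the derivatives involve K and E but not Lambda.\<close>

lemma phaseJ_derivatives_elliptic:
  assumes abc: "0 < a" "a < b" "b < c"
  defines "s \<equiv> modS 0 a b c"
  shows "((\<lambda>x. phaseJ x b c) has_real_derivative b * (ellK s - ellE s) / ((b - a) * (sqrt b * sqrt (c - a)))) (at a)"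
    and "((\<lambda>x. phaseJ a x c) has_real_derivative
           - (a * (ellK s - ellE s / (1 - s^2)) / ((b - a) * (sqrt b * sqrt (c - a))))) (at b)"
    and "((\<lambda>x. phaseJ a b x) has_real_derivative - (b * ellE s / ((c - b) * (sqrt b * sqrt (c - a))))) (at c)"
proof -
  note sp = modS_props[OF abc, folded s_def] and t = phaseMu_tan_scaling[OF abc, folded s_def]
  have s: "0 < s" "0 \<le> s" "s < 1" using sp by auto
  let ?P = "\<lambda>x. 1 - (parRho 0 a b)^2 * (sin x)^2" and ?D = "ellDelta s"
  let ?N = "sqrt b * ((c - a) * sqrt (c - a))"
  let ?\<theta> = "\<lambda>x. arctan (sqrt (a/b) * tan x)"
  have D: "?D x > 0" "?D x \<noteq> 0" for x using ellDelta_pos[of s x] s by auto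
  have scale: "C / ?N * g = sqrt (a/b) / ((cos x)^2 + (sqrt (a/b))^2 * (sin x)^2) * ((C * g * ?D x ^ 3 / ?P x) / phaseW a b c (?\<theta> x))"
    if x: "0 < x" "x < pi/2" for x C g
    unfolding t(1)[OF x] t(7)[OF x]
    using t(2)[OF x] D[of x] abc by (simp add: real_sqrt_divide power2_eq_square)
  have cont: "continuous_on {0..pi/2} (\<lambda>x. C * (f x / ?D x ^ 3))" if "continuous_on {0..pi/2} f" for f C
    using D that by (intro continuous_intros) auto
  have "integral {0..pi/2} (\<lambda>\<theta>. c * (cos \<theta>)^2 / phaseW a b c \<theta>) =
        integral {0..pi/2} (\<lambda>x. c / ?N * ((cos x)^2 / ?D x ^ 3))"
  proof (rule integral_tan_scaling[where r = "sqrt (a/b)"])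
    fix x :: real assume x: "0 < x" "x < pi/2"
    show "c / ?N * ((cos x)^2 / ?D x ^ 3) = sqrt (a/b) / ((cos x)^2 + (sqrt (a/b))^2 * (sin x)^2) *
       (c * (cos (?\<theta> x))^2 / phaseW a b c (?\<theta> x))"
      unfolding scale[OF x] t(6)[OF x] using D[of x] by simp
  next
    show "continuous_on {0..pi/2} (\<lambda>x. c / ?N * ((cos x)^2 / ?D x ^ 3))"
      by (intro cont continuous_intros)
  qed (use abc in auto)
  also have "\<dots> = c / ?N * ((ellK s - ellE s) / s^2)"
    unfolding integral_mult_right ellDelta_integrals(2)[OF s(1,3)] ..
  also have "\<dots> = b * (ellK s - ellE s) / ((b - a) * (sqrt b * sqrt (c - a)))"
    unfolding sp(1) using abc by (simp add: mult_ac)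
  finally show "((\<lambda>x. phaseJ x b c) has_real_derivative b * (ellK s - ellE s) / ((b - a) * (sqrt b * sqrt (c - a)))) (at a)"
    using phaseJ_derivatives(1)[OF abc] by simp
  have "integral {0..pi/2} (\<lambda>\<theta>. c * (sin \<theta>)^2 / phaseW a b c \<theta>) =
        integral {0..pi/2} (\<lambda>x. c * (a / b) / ?N * ((sin x)^2 / ?D x ^ 3))"
  proof (rule integral_tan_scaling[where r = "sqrt (a/b)"])
    fix x :: real assume x: "0 < x" "x < pi/2"
    show "c * (a / b) / ?N * ((sin x)^2 / ?D x ^ 3) = sqrt (a/b) / ((cos x)^2 + (sqrt (a/b))^2 * (sin x)^2) *
       (c * (sin (?\<theta> x))^2 / phaseW a b c (?\<theta> x))"
      unfolding scale[OF x] t(5)[OF x] using D[of x] by simp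
  next
    show "continuous_on {0..pi/2} (\<lambda>x. c * (a / b) / ?N * ((sin x)^2 / ?D x ^ 3))"
      by (intro cont continuous_intros)
  qed (use abc in auto)
  also have "\<dots> = c * (a / b) / ?N * ((ellE s / (1 - s^2) - ellK s) / s^2)"
    unfolding integral_mult_right ellDelta_integrals(1)[OF s(1,3)] ..
  also have "\<dots> = a * (ellE s / (1 - s^2) - ellK s) / ((b - a) * (sqrt b * sqrt (c - a)))"
    unfolding sp(1) using abc by (simp add: mult_ac)
  also have "\<dots> = - (a * (ellK s - ellE s / (1 - s^2)) / ((b - a) * (sqrt b * sqrt (c - a))))"
    by (metis minus_diff_eq minus_divide_left mult_minus_right)
  finally show "((\<lambda>x. phaseJ a x c) has_real_derivative
           - (a * (ellK s - ellE s / (1 - s^2)) / ((b - a) * (sqrt b * sqrt (c - a))))) (at b)"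
    using phaseJ_derivatives(2)[OF abc] by simp
  have "integral {0..pi/2} (\<lambda>\<theta>. - (phaseMu a b \<theta> / phaseW a b c \<theta>)) =
        integral {0..pi/2} (\<lambda>x. - a / ?N * (1 / ?D x ^ 3))"
  proof (rule integral_tan_scaling[where r = "sqrt (a/b)"])
    fix x :: real assume x: "0 < x" "x < pi/2"
    show "- a / ?N * (1 / ?D x ^ 3) = sqrt (a/b) / ((cos x)^2 + (sqrt (a/b))^2 * (sin x)^2) *
       - (phaseMu a b (?\<theta> x) / phaseW a b c (?\<theta> x))"
      unfolding scale[OF x] t(3)[OF x] using D[of x] by simp
  next
    show "continuous_on {0..pi/2} (\<lambda>x. - a / ?N * (1 / ?D x ^ 3))"
      by (intro cont continuous_intros)
  qed (use abc in auto)
  also have "\<dots> = - a / ?N * (ellE s / (1 - s^2))"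
    unfolding integral_mult_right integral_inverse_ellDelta_cube[OF s(2,3)] ..
  also have "\<dots> = - (b * ellE s / ((c - b) * (sqrt b * sqrt (c - a))))"
    unfolding sp(2) using abc by (simp add: mult_ac)
  finally show "((\<lambda>x. phaseJ a b x) has_real_derivative - (b * ellE s / ((c - b) * (sqrt b * sqrt (c - a))))) (at c)"
    using phaseJ_derivatives(3)[OF abc] by simp
qed

section \<open>Bounds for complete elliptic integrals\<close>

lemma integral_mono_continuous:
  fixes f g :: "real \<Rightarrow> real"
  assumes "continuous_on {a..b} f" "continuous_on {a..b} g" "\<And>x. a \<le> x \<Longrightarrow> x \<le> b \<Longrightarrow> f x \<le> g x"
  shows "integral {a..b} f \<le> integral {a..b} g"
  using assms by (intro integral_le integrable_continuous_real) auto

lemma integral_from_antiderivative: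
  fixes F f :: "real \<Rightarrow> real"
  assumes "a \<le> b" "\<And>x. (F has_real_derivative f x) (at x)"
  shows "integral {a..b} f = F b - F a"
  using assms
  by (intro integral_unique fundamental_theorem_of_calculus)
     (auto simp: has_real_derivative_iff_has_vector_derivative[symmetric] intro: has_field_derivative_at_within)

lemma integral_sin_squared: "integral {0..pi/2} (\<lambda>x. (sin x)^2) = pi/4"
proof -
  have "integral {0..pi/2} (\<lambda>x. (sin x)^2) =
      ((\<lambda>x. (x - sin x * cos x) / 2) (pi/2)) - (\<lambda>x. (x - sin x * cos x) / 2) 0"
  proof (rule integral_from_antiderivative)
    show "((\<lambda>x. (x - sin x * cos x) / 2) has_real_derivative (sin x)^2) (at x)" for x :: real
      using sin_cos_squared_add[of x]
      by (auto intro!: derivative_eq_intros simp: power2_eq_square)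
  qed simp
  then show ?thesis by simp
qed

lemma integral_cos_squared: "integral {0..pi/2} (\<lambda>x. (cos x)^2) = pi/4"
proof -
  have "integral {0..pi/2} (\<lambda>x. (cos x)^2) =
      ((\<lambda>x. (x + sin x * cos x) / 2) (pi/2)) - (\<lambda>x. (x + sin x * cos x) / 2) 0"
  proof (rule integral_from_antiderivative)
    show "((\<lambda>x. (x + sin x * cos x) / 2) has_real_derivative (cos x)^2) (at x)" for x :: real
      using sin_cos_squared_add[of x]
      by (auto intro!: derivative_eq_intros simp: power2_eq_square)
  qed simp
  then show ?thesis by simp
qed

lemma integral_cos: "integral {0..pi/2} cos = (1::real)"
  using integral_from_antiderivative[of 0 "pi/2" sin cos] by simp

text \<open>These integrate sqrt(1 - s^2) <= Delta <= 1. The weights 1, sin^2 and cos^2 yield bounds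
  for K, K - E and E - (1 - s^2) K whose two sides agree to leading order as s tends to 0.\<close>

lemma weighted_integral_bounds:
  assumes s: "0 \<le> s" "s < 1" and f: "continuous_on {0..pi/2} f" "\<And>x. 0 \<le> f x"
  shows "integral {0..pi/2} f \<le> integral {0..pi/2} (\<lambda>x. f x / ellDelta s x)"
    and "integral {0..pi/2} (\<lambda>x. f x / ellDelta s x) \<le> integral {0..pi/2} f / sqrt (1 - s^2)"
proof -
  have D: "ellDelta s x > 0" "ellDelta s x \<noteq> 0" for x using ellDelta_pos[OF s, of x] by auto
  have r: "sqrt (1 - s^2) > 0" using one_minus_square_pos[OF s] by simp
  have cont: "continuous_on {0..pi/2} (\<lambda>x. f x / ellDelta s x)"
    using D f(1) by (intro continuous_intros) auto
  show "integral {0..pi/2} f \<le> integral {0..pi/2} (\<lambda>x. f x / ellDelta s x)"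
  proof (rule integral_mono_continuous[OF f(1) cont])
    fix x show "f x \<le> f x / ellDelta s x"
      using D(1)[of x] f(2)[of x] ellDelta_le_1[of s x] mult_left_le[of "ellDelta s x" "f x"]
      by (simp add: pos_le_divide_eq)
  qed
  have "integral {0..pi/2} (\<lambda>x. f x / ellDelta s x) \<le> integral {0..pi/2} (\<lambda>x. f x / sqrt (1 - s^2))"
  proof (rule integral_mono_continuous[OF cont])
    show "continuous_on {0..pi/2} (\<lambda>x. f x / sqrt (1 - s^2))"
      using f(1) r by (intro continuous_intros) auto
    fix x show "f x / ellDelta s x \<le> f x / sqrt (1 - s^2)"
      using f(2)[of x] r D(1)[of x] ellDelta_ge_sqrt[of s x] by (intro divide_left_mono) auto
  qed
  then show "integral {0..pi/2} (\<lambda>x. f x / ellDelta s x) \<le> integral {0..pi/2} f / sqrt (1 - s^2)"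
    by simp
qed

text \<open>The first two bounds use the constant weight 1. The third captures the logarithmic
  divergence at s = 1 through a minorant of 1/Delta with an elementary antiderivative.\<close>

lemma ellK_bounds:
  assumes s: "0 \<le> s" "s < 1"
  shows "pi/2 \<le> ellK s" and "ellK s \<le> (pi/2) / sqrt (1 - s^2)" and "- ln (1 - s) / 2 \<le> ellK s"
proof -
  show "pi/2 \<le> ellK s" "ellK s \<le> (pi/2) / sqrt (1 - s^2)"
    using weighted_integral_bounds[OF s, of "\<lambda>_. 1"] by (auto simp: ellK_eq)
  have D: "ellDelta s x > 0" "ellDelta s x \<noteq> 0" for x using ellDelta_pos[OF s, of x] by auto
  have p: "0 < 1 - s * sin x" for x
  proof -
    have "s * sin x \<le> s * 1" using s by (intro mult_left_mono) auto
    then show ?thesis using s by simp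
  qed
  let ?F = "\<lambda>x. - ln (1 - s * sin x) / 2" and ?f = "\<lambda>x. s * cos x / (2 * (1 - s * sin x))"
  have "integral {0..pi/2} ?f = ?F (pi/2) - ?F 0"
  proof (rule integral_from_antiderivative)
    show "(?F has_real_derivative ?f x) (at x)" for x
      using p[of x] by (auto intro!: derivative_eq_intros simp: field_simps)
  qed simp
  moreover have "integral {0..pi/2} ?f \<le> integral {0..pi/2} (\<lambda>\<psi>. 1 / ellDelta s \<psi>)"
  proof (rule integral_mono_continuous)
    show "continuous_on {0..pi/2} ?f"
      using p by (intro continuous_intros) (auto simp: less_le)
    show "continuous_on {0..pi/2} (\<lambda>\<psi>. 1 / ellDelta s \<psi>)"
      using D by (intro continuous_intros) auto
    fix x :: real assume x: "0 \<le> x" "x \<le> pi/2"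
    have c: "0 \<le> cos x" "0 \<le> sin x" using x by (auto intro!: cos_ge_zero sin_ge_zero)
    \<comment> \<open>since \<open>s cos x \<le> cos x \<le> \<Delta>\<close> and \<open>\<Delta>\<^sup>2 = (1 - s sin x) (1 + s sin x) \<le> 2 (1 - s sin x)\<close>\<close>
    have "s * sin x \<le> 1" using p[of x] by simp
    have "s * cos x * ellDelta s x \<le> ellDelta s x * ellDelta s x"
      using ellDelta_ge_cos[OF s, of x] c s D(1)[of x] mult_right_mono[of s 1 "cos x"]
      by (intro mult_right_mono) auto
    also have "\<dots> = (1 + s * sin x) * (1 - s * sin x)"
      using ellDelta_square[OF s, of x] by (simp add: power2_eq_square algebra_simps)
    also have "\<dots> \<le> 2 * (1 - s * sin x)"
      using p[of x] by (intro mult_right_mono) auto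
    finally show "?f x \<le> 1 / ellDelta s x"
      using D(1)[of x] p[of x] by (simp add: divide_le_eq le_divide_eq mult_ac)
  qed
  ultimately show "- ln (1 - s) / 2 \<le> ellK s" by (simp add: ellK_eq)
qed

text \<open>The pointwise bounds are cos <= Delta <= 1 and sqrt(1 - s^2) <= Delta. The bound 1 keeps
  E away from 0 as s tends to 1; the last one serves the limit s to 0.\<close>

lemma ellE_bounds:
  assumes s: "0 \<le> s" "s < 1"
  shows "1 \<le> ellE s" and "ellE s \<le> pi/2" and "(pi/2) * sqrt (1 - s^2) \<le> ellE s"
proof -
  have "integral {0..pi/2} cos \<le> integral {0..pi/2} (ellDelta s)"
    by (intro integral_mono_continuous continuous_intros ellDelta_ge_cos[OF s])
  then show "1 \<le> ellE s" by (simp add: ellE_eq integral_cos)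
  have "integral {0..pi/2} (ellDelta s) \<le> integral {0..pi/2} (\<lambda>_. 1)"
    by (intro integral_mono_continuous continuous_intros ellDelta_le_1)
  then show "ellE s \<le> pi/2" by (simp add: ellE_eq)
  have "integral {0..pi/2} (\<lambda>_. sqrt (1 - s^2)) \<le> integral {0..pi/2} (ellDelta s)"
    by (intro integral_mono_continuous continuous_intros ellDelta_ge_sqrt)
  then show "(pi/2) * sqrt (1 - s^2) \<le> ellE s" by (simp add: ellE_eq)
qed

text \<open>The two differences equal s^2 times the integrals of sin^2 / Delta and cos^2 / Delta.
  Since sin^2 and cos^2 have the same integral pi/4, both differences obey the same bounds.\<close>

lemma ellK_ellE_difference_bounds:
  assumes s: "0 \<le> s" "s < 1"
  shows "pi/4 * s^2 \<le> ellK s - ellE s"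
    and "ellK s - ellE s \<le> pi/4 * s^2 / sqrt (1 - s^2)"
    and "pi/4 * s^2 \<le> ellE s - (1 - s^2) * ellK s"
    and "ellE s - (1 - s^2) * ellK s \<le> pi/4 * s^2 / sqrt (1 - s^2)"
proof -
  let ?D = "ellDelta s"
  have D: "?D x > 0" "?D x \<noteq> 0" for x using ellDelta_pos[OF s, of x] by auto
  have i: "(\<lambda>x. 1 / ?D x) integrable_on {0..pi/2}" "?D integrable_on {0..pi/2}"
    using D by (auto intro!: integrable_continuous_real continuous_intros)
  have DD: "?D x = (?D x)^2 / ?D x" for x
    using D[of x] by (simp add: power2_eq_square)
  have "ellK s - ellE s = integral {0..pi/2} (\<lambda>x. 1 / ?D x - ?D x)"
    unfolding ellK_eq ellE_eq using i by (simp add: integral_diff)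
  also have "\<dots> = integral {0..pi/2} (\<lambda>x. s^2 * ((sin x)^2 / ?D x))"
    by (subst (2) DD) (simp add: ellDelta_square[OF s] diff_divide_distrib)
  finally have 1: "ellK s - ellE s = s^2 * integral {0..pi/2} (\<lambda>x. (sin x)^2 / ?D x)"
    unfolding integral_mult_right .
  have eq: "?D x - (1 - s^2) * (1 / ?D x) = s^2 * ((cos x)^2 / ?D x)" for x
  proof -
    have "?D x - (1 - s^2) * (1 / ?D x) = ((?D x)^2 - (1 - s^2)) / ?D x"
      using D[of x] by (simp add: power2_eq_square diff_divide_distrib)
    also have "(?D x)^2 - (1 - s^2) = s^2 * (cos x)^2"
      unfolding ellDelta_square[OF s] cos_squared_eq by (simp add: algebra_simps)
    finally show ?thesis by simp
  qed
  have "ellE s - (1 - s^2) * ellK s = integral {0..pi/2} (\<lambda>x. ?D x - (1 - s^2) * (1 / ?D x))"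
    unfolding ellK_eq ellE_eq integral_mult_right[symmetric]
    by (intro integral_diff[symmetric] i integrable_on_mult_right)
  then have 2: "ellE s - (1 - s^2) * ellK s = s^2 * integral {0..pi/2} (\<lambda>x. (cos x)^2 / ?D x)"
    unfolding eq integral_mult_right .
  note sn = weighted_integral_bounds[OF s, of "\<lambda>x. (sin x)^2", unfolded integral_sin_squared]
  note cs = weighted_integral_bounds[OF s, of "\<lambda>x. (cos x)^2", unfolded integral_cos_squared]
  have c: "continuous_on {0..pi/2} (\<lambda>x::real. (sin x)^2)" "continuous_on {0..pi/2} (\<lambda>x::real. (cos x)^2)"
    by (intro continuous_intros)+
  show "pi/4 * s^2 \<le> ellK s - ellE s" "ellK s - ellE s \<le> pi/4 * s^2 / sqrt (1 - s^2)"
    unfolding 1 using mult_left_mono[OF sn(1), of "s^2"] mult_left_mono[OF sn(2), of "s^2"] c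
    by (simp_all add: mult_ac)
  show "pi/4 * s^2 \<le> ellE s - (1 - s^2) * ellK s"
       "ellE s - (1 - s^2) * ellK s \<le> pi/4 * s^2 / sqrt (1 - s^2)"
    unfolding 2 using mult_left_mono[OF cs(1), of "s^2"] mult_left_mono[OF cs(2), of "s^2"] c
    by (simp_all add: mult_ac)
qed

text \<open>With P = 1 - rho^2 sin^2, the third bound rests on 1/(1 - rho^2) - 1/P = rho^2 cos^2 /
  ((1 - rho^2) P). One factor cos absorbs 1/Delta, and the other integrates to 1, so the error stays
  bounded while K diverges.\<close>

lemma ellLambda_bounds:
  assumes s: "0 \<le> s" "s < 1" and \<rho>: "0 \<le> \<rho>" "\<rho> < 1"
  shows "ellK s \<le> ellLambda \<rho> s" and "ellLambda \<rho> s \<le> ellK s / (1 - \<rho>^2)"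
    and "ellK s / (1 - \<rho>^2) - \<rho>^2 / (1 - \<rho>^2)^2 \<le> ellLambda \<rho> s"
proof -
  let ?D = "ellDelta s" and ?P = "\<lambda>x. 1 - \<rho>^2 * (sin x)^2"
  have D: "?D x > 0" "?D x \<noteq> 0" for x using ellDelta_pos[OF s, of x] by auto
  have P: "0 < ?P x" "?P x \<le> 1" "1 - \<rho>^2 \<le> ?P x" "?P x \<noteq> 0" for x
    using rho_factor_pos[OF \<rho>, of x] ellDelta_arg_ge[of \<rho> x] by auto
  have r: "0 < 1 - \<rho>^2" by (rule one_minus_square_pos[OF \<rho>])
  have cK: "continuous_on {0..pi/2} (\<lambda>x. 1 / ?D x)"
    using D by (intro continuous_intros) auto
  note cL = continuous_on_ellLambda_integrand[OF s \<rho>, of "{0..pi/2}"]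
  have "integral {0..pi/2} (\<lambda>x. 1 / ?D x) \<le> integral {0..pi/2} (\<lambda>x. 1 / (?P x * ?D x))"
  proof (rule integral_mono_continuous[OF cK cL])
    fix x show "1 / ?D x \<le> 1 / (?P x * ?D x)"
      using D(1)[of x] P[of x] mult_right_mono[of "?P x" 1 "?D x"] by (intro divide_left_mono) auto
  qed
  then show "ellK s \<le> ellLambda \<rho> s" unfolding ellLambda_eq[OF assms] ellK_eq .
  have "integral {0..pi/2} (\<lambda>x. 1 / (?P x * ?D x)) \<le> integral {0..pi/2} (\<lambda>x. 1 / (1 - \<rho>^2) * (1 / ?D x))"
  proof (rule integral_mono_continuous[OF cL])
    show "continuous_on {0..pi/2} (\<lambda>x. 1 / (1 - \<rho>^2) * (1 / ?D x))"
      by (intro continuous_on_mult continuous_on_const cK)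
    fix x
    have "1 / ?P x * (1 / ?D x) \<le> 1 / (1 - \<rho>^2) * (1 / ?D x)"
      using D(1)[of x] P[of x] r by (intro mult_right_mono divide_left_mono) auto
    then show "1 / (?P x * ?D x) \<le> 1 / (1 - \<rho>^2) * (1 / ?D x)" by simp
  qed
  then show "ellLambda \<rho> s \<le> ellK s / (1 - \<rho>^2)"
    unfolding ellLambda_eq[OF assms] ellK_eq integral_mult_right by simp
  let ?c = "\<rho>^2 / (1 - \<rho>^2)^2"
  have "integral {0..pi/2} (\<lambda>x. 1 / (1 - \<rho>^2) * (1 / ?D x) - ?c * cos x) \<le>
        integral {0..pi/2} (\<lambda>x. 1 / (?P x * ?D x))"
  proof (rule integral_mono_continuous[OF _ cL])
    show "continuous_on {0..pi/2} (\<lambda>x. 1 / (1 - \<rho>^2) * (1 / ?D x) - ?c * cos x)"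
      by (intro continuous_on_mult continuous_on_const cK continuous_on_diff continuous_on_cos continuous_on_id)
    fix x :: real assume x: "0 \<le> x" "x \<le> pi/2"
    have c: "0 \<le> cos x" using x by (intro cos_ge_zero) auto
    have "1 / (1 - \<rho>^2) - 1 / ?P x = (?P x - (1 - \<rho>^2)) / ((1 - \<rho>^2) * ?P x)"
      using P(4)[of x] r by (subst diff_frac_eq) auto
    also have "?P x - (1 - \<rho>^2) = \<rho>^2 * (cos x)^2"
      unfolding cos_squared_eq by (simp add: algebra_simps)
    also have "\<rho>^2 * (cos x)^2 / ((1 - \<rho>^2) * ?P x) \<le> \<rho>^2 * (cos x)^2 / ((1 - \<rho>^2) * (1 - \<rho>^2))"
      using P[of x] r by (intro divide_left_mono mult_left_mono mult_pos_pos) auto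
    finally have "1 / (1 - \<rho>^2) - 1 / ?P x \<le> ?c * (cos x)^2"
      by (simp add: power2_eq_square)
    then have "(1 / (1 - \<rho>^2) - 1 / ?P x) * (1 / ?D x) \<le> ?c * (cos x)^2 * (1 / ?D x)"
      using D(1)[of x] by (intro mult_right_mono) auto
    also have "\<dots> = ?c * cos x * (cos x / ?D x)" by (simp add: power2_eq_square)
    also have "\<dots> \<le> ?c * cos x * 1"
      using ellDelta_ge_cos[OF s, of x] D(1)[of x] c by (intro mult_left_mono) auto
    finally show "1 / (1 - \<rho>^2) * (1 / ?D x) - ?c * cos x \<le> 1 / (?P x * ?D x)"
      by (simp add: diff_divide_distrib)
  qed
  moreover have "integral {0..pi/2} (\<lambda>x. 1 / (1 - \<rho>^2) * (1 / ?D x) - ?c * cos x) =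
     1 / (1 - \<rho>^2) * ellK s - ?c * integral {0..pi/2} cos"
    unfolding ellK_eq integral_mult_right[symmetric]
    by (intro integral_diff integrable_continuous_real continuous_on_mult continuous_on_const cK
          continuous_on_cos continuous_on_id)
  ultimately show "ellK s / (1 - \<rho>^2) - ?c \<le> ellLambda \<rho> s"
    unfolding ellLambda_eq[OF assms] integral_cos by simp
qed

section \<open>Characteristic speeds\<close>

text \<open>For omega = (d + y) k the quotient omega'/k' is d + y + k/k', and k = pi / J turns k/k'
  into -J/J'. The relation k = pi / J on a neighbourhood of \<open>x\<close> suffices for the
  derivatives.\<close>

lemma deriv_quotient_phase:
  fixes J k :: "real \<Rightarrow> real"
  assumes J: "(J has_real_derivative J') (at x)" "J x \<noteq> 0" "J' \<noteq> 0"
    and S: "open S" "x \<in> S" "\<And>y. y \<in> S \<Longrightarrow> k y = pi / J y"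
  shows "deriv (\<lambda>y. (d + y) * k y) x / deriv k x = d + x - J x / J'"
proof -
  have "((\<lambda>y. pi / J y) has_real_derivative - (pi * J' / (J x)^2)) (at x)"
    using J by (auto intro!: derivative_eq_intros simp: power2_eq_square)
  then have k: "(k has_real_derivative - (pi * J' / (J x)^2)) (at x)"
    by (rule has_field_derivative_transform_within_open[OF _ S(1,2)]) (simp add: S(3))
  then have w: "((\<lambda>y. (d + y) * k y) has_real_derivative k x + (d + x) * - (pi * J' / (J x)^2)) (at x)"
    by (auto intro!: derivative_eq_intros)
  have "(pi / J x + (d + x) * - (pi * J' / (J x)^2)) / - (pi * J' / (J x)^2) = d + x - J x / J'"
    using J by (simp add: field_simps power2_eq_square)
  then show ?thesis
    unfolding DERIV_imp_deriv[OF k] DERIV_imp_deriv[OF w] S(3)[OF S(2)] .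
qed

text \<open>These signs keep the denominators of the speeds from vanishing and decide the
  ordering.\<close>

lemma elliptic_pos:
  fixes a b c :: real
  assumes abc: "0 < a" "a < b" "b < c"
  defines "s \<equiv> modS 0 a b c"
  shows "0 < ellK s - ellE s" "0 < ellE s - (1 - s^2) * ellK s" "0 < ellE s" "0 < ellK s"
    "0 < 1 - s^2" "0 < ellLambda (parRho 0 a b) s"
proof -
  note sp = modS_props[OF abc, folded s_def] and rp = parRho_props[OF abc(1,2)]
  have s: "0 \<le> s" "s < 1" "0 < s^2"
    using sp(3,4) by auto
  show "0 < ellK s - ellE s" "0 < ellE s - (1 - s^2) * ellK s" "0 < ellE s" and K: "0 < ellK s"
    using ellK_ellE_difference_bounds[OF s(1,2)] ellE_bounds[OF s(1,2)] ellK_bounds[OF s(1,2)] s(3) pi_gt_zero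
      mult_pos_pos[of "pi/4" "s^2"] by linarith+
  show "0 < 1 - s^2" by (rule one_minus_square_pos[OF s(1,2)])
  show "0 < ellLambda (parRho 0 a b) s"
    using ellLambda_bounds(1)[OF s(1,2), of "parRho 0 a b"] K rp by linarith
qed

text \<open>The common factor N = sqrt b sqrt(c - a) drops out of J / J'. The second speed is
  cleared of 1/(1 - s^2), so that every fraction following the common sum u1 + u2 + u3 + 2 nu is
  positive and suited to limits.\<close>

lemma speeds_eq:
  fixes nu u1 u2 u3 :: real
  assumes h: "- nu < u1" "u1 < u2" "u2 < u3"
  defines "s \<equiv> modS nu u1 u2 u3"
  defines "L \<equiv> ellLambda (parRho nu u1 u2) s"
  shows "speed1 nu u1 u2 u3 = u1 + u2 + u3 + 2 * nu
           - 2 * (u2 - u1) * ((u1 + nu) * L / ((u2 + nu) * (ellK s - ellE s)))"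
    and "speed2 nu u1 u2 u3 = u1 + u2 + u3 + 2 * nu
           - 2 * (u2 - u1) * (((1 - s^2) * L) / (ellE s - (1 - s^2) * ellK s))"
    and "speed3 nu u1 u2 u3 = u1 + u2 + u3 + 2 * nu
           + 2 * (u3 - u2) * ((u1 + nu) * L / ((u2 + nu) * ellE s))"
proof -
  define a b c where "a = u1 + nu" and "b = u2 + nu" and "c = u3 + nu"
  have abc: "0 < a" "a < b" "b < c" using h by (auto simp: a_def b_def c_def)
  have s_eq: "s = modS 0 a b c" and L_eq: "L = ellLambda (parRho 0 a b) s"
    unfolding L_def s_def a_def b_def c_def using modS_shift[of nu] parRho_shift[of nu] by auto
  define N where "N = sqrt b * sqrt (c - a)"
  have N: "N > 0" unfolding N_def using abc by simp
  have J: "phaseJ a b c = 2 * a * L / N"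
    unfolding phaseJ_eq_ellLambda[OF abc] L_eq s_eq N_def ..
  note dJ = phaseJ_derivatives_elliptic[OF abc, folded s_eq N_def]
  note KE = elliptic_pos(1-4)[OF abc, folded s_eq] and s2 = elliptic_pos(5)[OF abc, folded s_eq]
    and L = elliptic_pos(6)[OF abc, folded s_eq, folded L_eq]
  have Jnz: "phaseJ a b c \<noteq> 0" unfolding J using abc L N by simp
  have KE2: "ellK s - ellE s / (1 - s^2) = - ((ellE s - (1 - s^2) * ellK s) / (1 - s^2))"
    using s2 by (simp add: field_simps)
  have "speed1 nu u1 u2 u3 = (2 * nu + u2 + u3) + u1
      - phaseJ a b c / (b * (ellK s - ellE s) / ((b - a) * N))"
  proof -
    have "((\<lambda>y. phaseJ (y + nu) b c) has_real_derivative b * (ellK s - ellE s) / ((b - a) * N)) (at u1)"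
      by (rule DERIV_shift[THEN iffD1]) (use dJ(1) in \<open>simp add: a_def\<close>)
    moreover have "phaseJ (u1 + nu) b c \<noteq> 0"
      using Jnz by (simp add: a_def b_def c_def)
    moreover have "b * (ellK s - ellE s) / ((b - a) * N) \<noteq> 0"
      using KE N abc by simp
    moreover have "wavenumber nu y u2 u3 = pi / phaseJ (y + nu) b c" if "y \<in> {-nu<..<u2}" for y
      using that h by (simp add: wavenumber_eq_phaseJ a_def b_def c_def)
    ultimately have "deriv (\<lambda>y. (2 * nu + u2 + u3 + y) * wavenumber nu y u2 u3) u1 / deriv (\<lambda>y. wavenumber nu y u2 u3) u1
        = 2 * nu + u2 + u3 + u1 - phaseJ (u1 + nu) b c / (b * (ellK s - ellE s) / ((b - a) * N))"
      using h by (intro deriv_quotient_phase[where S = "{-nu<..<u2}"]) auto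
    moreover have "(\<lambda>y. frequency nu y u2 u3) = (\<lambda>y. (2 * nu + u2 + u3 + y) * wavenumber nu y u2 u3)"
      by (simp add: frequency_def algebra_simps)
    ultimately show ?thesis
      by (simp add: speed1_def a_def)
  qed
  also have "phaseJ a b c / (b * (ellK s - ellE s) / ((b - a) * N)) =
      2 * (b - a) * (a * L / (b * (ellK s - ellE s)))"
    unfolding J using N by simp
  finally show "speed1 nu u1 u2 u3 = u1 + u2 + u3 + 2 * nu
           - 2 * (u2 - u1) * ((u1 + nu) * L / ((u2 + nu) * (ellK s - ellE s)))"
    by (simp add: a_def b_def)
  have "speed2 nu u1 u2 u3 = (2 * nu + u1 + u3) + u2
      - phaseJ a b c / - (a * (ellK s - ellE s / (1 - s^2)) / ((b - a) * N))"
  proof -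
    have "((\<lambda>y. phaseJ a (y + nu) c) has_real_derivative - (a * (ellK s - ellE s / (1 - s^2)) / ((b - a) * N))) (at u2)"
      by (rule DERIV_shift[THEN iffD1]) (use dJ(2) in \<open>simp add: b_def\<close>)
    moreover have "phaseJ a (u2 + nu) c \<noteq> 0"
      using Jnz by (simp add: a_def b_def c_def)
    moreover have "- (a * (ellK s - ellE s / (1 - s^2)) / ((b - a) * N)) \<noteq> 0"
      unfolding KE2 using KE N abc s2 by simp
    moreover have "wavenumber nu u1 y u3 = pi / phaseJ a (y + nu) c" if "y \<in> {u1<..<u3}" for y
      using that h by (simp add: wavenumber_eq_phaseJ a_def b_def c_def)
    ultimately have "deriv (\<lambda>y. (2 * nu + u1 + u3 + y) * wavenumber nu u1 y u3) u2 / deriv (\<lambda>y. wavenumber nu u1 y u3) u2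
        = 2 * nu + u1 + u3 + u2 - phaseJ a (u2 + nu) c / (- (a * (ellK s - ellE s / (1 - s^2)) / ((b - a) * N)))"
      using h by (intro deriv_quotient_phase[where S = "{u1<..<u3}"]) auto
    moreover have "(\<lambda>y. frequency nu u1 y u3) = (\<lambda>y. (2 * nu + u1 + u3 + y) * wavenumber nu u1 y u3)"
      by (simp add: frequency_def algebra_simps)
    ultimately show ?thesis
      by (simp add: speed2_def b_def)
  qed
  also have "phaseJ a b c / - (a * (ellK s - ellE s / (1 - s^2)) / ((b - a) * N)) =
      2 * (b - a) * (((1 - s^2) * L) / (ellE s - (1 - s^2) * ellK s))"
    unfolding J KE2 using N abc by simp
  finally show "speed2 nu u1 u2 u3 = u1 + u2 + u3 + 2 * nu
           - 2 * (u2 - u1) * (((1 - s^2) * L) / (ellE s - (1 - s^2) * ellK s))"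
    by (simp add: a_def b_def)
  have "speed3 nu u1 u2 u3 = (2 * nu + u1 + u2) + u3
      - phaseJ a b c / - (b * ellE s / ((c - b) * N))"
  proof -
    have "((\<lambda>y. phaseJ a b (y + nu)) has_real_derivative - (b * ellE s / ((c - b) * N))) (at u3)"
      by (rule DERIV_shift[THEN iffD1]) (use dJ(3) in \<open>simp add: c_def\<close>)
    moreover have "phaseJ a b (u3 + nu) \<noteq> 0"
      using Jnz by (simp add: a_def b_def c_def)
    moreover have "- (b * ellE s / ((c - b) * N)) \<noteq> 0"
      using KE N abc by simp
    moreover have "wavenumber nu u1 u2 y = pi / phaseJ a b (y + nu)" if "y \<in> {u2<..}" for y
      using that h by (simp add: wavenumber_eq_phaseJ a_def b_def c_def)
    ultimately have "deriv (\<lambda>y. (2 * nu + u1 + u2 + y) * wavenumber nu u1 u2 y) u3 / deriv (\<lambda>y. wavenumber nu u1 u2 y) u3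
        = 2 * nu + u1 + u2 + u3 - phaseJ a b (u3 + nu) / (- (b * ellE s / ((c - b) * N)))"
      using h by (intro deriv_quotient_phase[where S = "{u2<..}"]) auto
    moreover have "(\<lambda>y. frequency nu u1 u2 y) = (\<lambda>y. (2 * nu + u1 + u2 + y) * wavenumber nu u1 u2 y)"
      by (simp add: frequency_def algebra_simps)
    ultimately show ?thesis
      by (simp add: speed3_def c_def)
  qed
  also have "phaseJ a b c / - (b * ellE s / ((c - b) * N)) = - (2 * (c - b) * (a * L / (b * ellE s)))"
    unfolding J using N by simp
  finally show "speed3 nu u1 u2 u3 = u1 + u2 + u3 + 2 * nu
           + 2 * (u3 - u2) * ((u1 + nu) * L / ((u2 + nu) * ellE s))"
    by (simp add: a_def b_def c_def)
qed

section \<open>Coalescing Riemann invariants\<close>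

text \<open>Here s tends to 1. The second and third speeds need only (1 - s^2) Lambda to vanish,
  whereas the first needs the exact ratio of Lambda to K - E. A general filter covers every approach
  to (v, v) with x < y.\<close>

lemma speeds_limit_upper:
  fixes nu u v :: real and x y :: "'a \<Rightarrow> real"
  assumes uv: "- nu < u" "u < v"
    and x: "(x \<longlongrightarrow> v) F" and y: "(y \<longlongrightarrow> v) F"
    and ev: "eventually (\<lambda>p. u < x p \<and> x p < y p) F"
  shows "((\<lambda>p. speed1 nu u (x p) (y p)) \<longlongrightarrow> 3 * u + 2 * nu) F"
    and "((\<lambda>p. speed2 nu u (x p) (y p)) \<longlongrightarrow> u + 2 * v + 2 * nu) F"
    and "((\<lambda>p. speed3 nu u (x p) (y p)) \<longlongrightarrow> u + 2 * v + 2 * nu) F"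
proof -
  define a d where "a = u + nu" and "d = v + nu"
  define b c where "b p = x p + nu" and "c p = y p + nu" for p
  define s where "s p = modS nu u (x p) (y p)" for p
  define L where "L p = ellLambda (parRho nu u (x p)) (s p)" for p
  have ad: "0 < a" "a < d" using uv by (auto simp: a_def d_def)
  have b: "(b \<longlongrightarrow> d) F" and c: "(c \<longlongrightarrow> d) F"
    unfolding b_def d_def c_def by (intro tendsto_intros x y)+
  have s_eq: "s p = modS 0 a (b p) (c p)" and L_eq: "L p = ellLambda (parRho 0 a (b p)) (s p)" for p
    unfolding L_def s_def a_def b_def c_def using modS_shift[of nu] parRho_shift[of nu] by auto
  have ev: "eventually (\<lambda>p. a < b p \<and> b p < c p) F"
    using ev by eventually_elim (auto simp: a_def b_def c_def)
  have "(s \<longlongrightarrow> sqrt ((d - a) * (d + 0) / ((d - a) * (d + 0)))) F"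
    unfolding s_eq modS_def using ad by (intro tendsto_intros b c) auto
  then have s: "(s \<longlongrightarrow> 1) F" using ad by simp
  have ev_s: "eventually (\<lambda>p. 0 \<le> s p \<and> s p < 1) F"
    using ev by eventually_elim (use modS_props ad in \<open>auto simp: s_eq less_imp_le\<close>)
  have V: "((\<lambda>p. u + x p + y p + 2 * nu) \<longlongrightarrow> u + 2 * v + 2 * nu) F"
    by (rule tendsto_eq_rhs[where x = "u + v + v + 2 * nu"], intro tendsto_intros x y) simp

  \<comment> \<open>Since Lambda <= K b / a and K <= (pi/2) / sqrt(1 - s^2), the product is O(sqrt(1
    - s^2)).\<close>
  have R: "((\<lambda>p. (1 - (s p)^2) * L p) \<longlongrightarrow> 0) F"
  proof (rule tendsto_sandwich[OF _ _ tendsto_const])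
    show "eventually (\<lambda>p. 0 \<le> (1 - (s p)^2) * L p) F"
      using ev by eventually_elim
        (use elliptic_pos(5,6)[OF ad(1)] in \<open>auto simp: s_eq L_eq intro!: mult_nonneg_nonneg less_imp_le\<close>)
    show "eventually (\<lambda>p. (1 - (s p)^2) * L p \<le> sqrt (1 - (s p)^2) * (pi/2) * (b p / a)) F"
      using ev ev_s
    proof eventually_elim
      case (elim p)
      have e: "0 < 1 - (s p)^2" using one_minus_square_pos elim by auto
      have "L p \<le> ellK (s p) / (a / b p)"
        using ellLambda_bounds(2)[of "s p" "parRho 0 a (b p)"] elim parRho_props[of a "b p"] ad(1)
        by (simp add: L_eq)
      also have "\<dots> \<le> (pi/2) / sqrt (1 - (s p)^2) / (a / b p)"
        using ellK_bounds(2)[of "s p"] elim ad(1) by (intro divide_right_mono) auto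
      finally have "(1 - (s p)^2) * L p \<le> (1 - (s p)^2) * ((pi/2) / sqrt (1 - (s p)^2) / (a / b p))"
        using e by (intro mult_left_mono) auto
      also have "\<dots> = ((1 - (s p)^2) / sqrt (1 - (s p)^2)) * (pi/2) * (b p / a)"
        by simp
      finally show ?case using e by (simp only: real_div_sqrt less_imp_le)
    qed
    have "((\<lambda>p. sqrt (1 - (s p)^2) * (pi/2) * (b p / a)) \<longlongrightarrow> sqrt (1 - 1^2) * (pi/2) * (d / a)) F"
      using ad by (intro tendsto_intros s b) auto
    then show "((\<lambda>p. sqrt (1 - (s p)^2) * (pi/2) * (b p / a)) \<longlongrightarrow> 0) F" by simp
  qed

  \<comment> \<open>The gap satisfies (c - b) a / b = (1 - s^2)(c - a), which supplies the factor 1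
    - s^2 needed to apply \<open>R\<close>; E >= 1 handles the denominator.\<close>
  have "((\<lambda>p. 2 * (y p - x p) * (a * L p / (b p * ellE (s p)))) \<longlongrightarrow> 0) F"
  proof (rule tendsto_sandwich[OF _ _ tendsto_const])
    show "eventually (\<lambda>p. 0 \<le> 2 * (y p - x p) * (a * L p / (b p * ellE (s p)))) F"
      using ev by eventually_elim
        (use elliptic_pos(3,6)[OF ad(1)] ad in \<open>auto simp: s_eq L_eq b_def c_def less_imp_le\<close>)
    show "eventually (\<lambda>p. 2 * (y p - x p) * (a * L p / (b p * ellE (s p))) \<le> 2 * (c p - a) * ((1 - (s p)^2) * L p)) F"
      using ev ev_s
    proof eventually_elim
      case (elim p)
      have E: "1 \<le> ellE (s p)" using ellE_bounds elim by auto
      have gap: "(y p - x p) * (a / b p) = (1 - (s p)^2) * (c p - a)"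
        using modS_props(2)[of a "b p" "c p"] elim ad by (simp add: s_eq) (simp add: b_def c_def)
      have "2 * (y p - x p) * (a * L p / (b p * ellE (s p))) = 2 * (c p - a) * ((1 - (s p)^2) * L p) / ellE (s p)"
        using arg_cong[OF gap, of "\<lambda>z. 2 * z * L p / ellE (s p)"] by (simp add: mult_ac)
      also have "\<dots> \<le> 2 * (c p - a) * ((1 - (s p)^2) * L p) / 1"
        using E elim ad elliptic_pos(5,6)[of a "b p" "c p"]
        by (intro divide_left_mono mult_nonneg_nonneg) (auto simp: s_eq L_eq less_imp_le)
      finally show ?case by simp
    qed
    have "((\<lambda>p. 2 * (c p - a) * ((1 - (s p)^2) * L p)) \<longlongrightarrow> 2 * (d - a) * 0) F"
      by (intro tendsto_mult[OF _ R] tendsto_intros c)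
    then show "((\<lambda>p. 2 * (c p - a) * ((1 - (s p)^2) * L p)) \<longlongrightarrow> 0) F" by simp
  qed
  from tendsto_add[OF V this]
  have "((\<lambda>p. u + x p + y p + 2 * nu + 2 * (y p - x p) * (a * L p / (b p * ellE (s p)))) \<longlongrightarrow> u + 2 * v + 2 * nu) F"
    by simp
  then show "((\<lambda>p. speed3 nu u (x p) (y p)) \<longlongrightarrow> u + 2 * v + 2 * nu) F"
    by (rule Lim_transform_eventually)
       (use ev in eventually_elim, use speeds_eq(3)[of nu u] uv in \<open>auto simp: s_def L_def a_def b_def c_def\<close>)

  \<comment> \<open>The denominator is at least pi s^2 / 4, hence bounded away from 0 near s =
    1.\<close>
  have "((\<lambda>p. 2 * (x p - u) * (((1 - (s p)^2) * L p) / (ellE (s p) - (1 - (s p)^2) * ellK (s p)))) \<longlongrightarrow> 0) F"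
  proof (rule tendsto_sandwich[OF _ _ tendsto_const])
    show "eventually (\<lambda>p. 0 \<le> 2 * (x p - u) * (((1 - (s p)^2) * L p) / (ellE (s p) - (1 - (s p)^2) * ellK (s p)))) F"
      using ev by eventually_elim
        (use elliptic_pos(2,5,6)[OF ad(1)] in
          \<open>auto simp: s_eq L_eq a_def b_def c_def less_imp_le intro!: mult_nonneg_nonneg divide_nonneg_nonneg\<close>)
    show "eventually (\<lambda>p. 2 * (x p - u) * (((1 - (s p)^2) * L p) / (ellE (s p) - (1 - (s p)^2) * ellK (s p)))
        \<le> 2 * (x p - u) * (((1 - (s p)^2) * L p) / (pi/4 * (s p)^2))) F"
      using ev ev_s
    proof eventually_elim
      case (elim p)
      have "0 < s p" using elim ad modS_props(3) by (auto simp: s_eq)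
      then show ?case
        using elim ad elliptic_pos(2,5,6)[of a "b p" "c p"] ellK_ellE_difference_bounds(3)[of "s p"]
        by (intro mult_left_mono divide_left_mono mult_nonneg_nonneg mult_pos_pos)
           (auto simp: s_eq L_eq a_def b_def less_imp_le)
    qed
    have "((\<lambda>p. 2 * (x p - u) * (((1 - (s p)^2) * L p) / (pi/4 * (s p)^2))) \<longlongrightarrow> 2 * (v - u) * (0 / (pi/4 * 1^2))) F"
      by (intro tendsto_mult tendsto_divide[OF R] tendsto_intros s x) auto
    then show "((\<lambda>p. 2 * (x p - u) * (((1 - (s p)^2) * L p) / (pi/4 * (s p)^2))) \<longlongrightarrow> 0) F" by simp
  qed
  from tendsto_diff[OF V this]
  have "((\<lambda>p. u + x p + y p + 2 * nu
      - 2 * (x p - u) * (((1 - (s p)^2) * L p) / (ellE (s p) - (1 - (s p)^2) * ellK (s p)))) \<longlongrightarrow> u + 2 * v + 2 * nu) F"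
    by simp
  then show "((\<lambda>p. speed2 nu u (x p) (y p)) \<longlongrightarrow> u + 2 * v + 2 * nu) F"
    by (rule Lim_transform_eventually)
       (use ev in eventually_elim, use speeds_eq(2)[of nu u] uv in \<open>auto simp: s_def L_def a_def b_def c_def\<close>)

  have "((\<lambda>p. 1 - s p) \<longlongrightarrow> 1 - 1) F" by (intro tendsto_intros s)
  then have "filterlim (\<lambda>p. 1 - s p) (at_right 0) F"
    using ev_s by (auto simp: filterlim_at elim: eventually_mono)
  from filterlim_compose[OF ln_at_0 this]
  have "filterlim (\<lambda>p. - ln (1 - s p)) at_top F"
    by (simp add: filterlim_uminus_at_top)
  then have "filterlim (\<lambda>p. (1/2) * - ln (1 - s p)) at_top F"
    by (intro filterlim_tendsto_pos_mult_at_top[OF tendsto_const]) auto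
  then have K: "filterlim (\<lambda>p. ellK (s p)) at_top F"
    by (rule filterlim_at_top_mono)
       (use ev_s in eventually_elim, use ellK_bounds(3) in auto)
  have K': "filterlim (\<lambda>p. - (pi/2) + ellK (s p)) at_top F"
    by (rule filterlim_tendsto_add_at_top[OF tendsto_const K])
  \<comment> \<open>As a / b = 1 - rho^2, the quantity (a/b) Lambda lies between K - (b - a)/a and
    K. It therefore differs from K - E by at most (b - a)/a + pi/2, which is negligible against K -
    pi/2.\<close>
  have "((\<lambda>p. a * L p / (b p * (ellK (s p) - ellE (s p))) - 1) \<longlongrightarrow> 0) F"
  proof (rule Lim_null_comparison)
    show "eventually (\<lambda>p. norm (a * L p / (b p * (ellK (s p) - ellE (s p))) - 1)
        \<le> ((b p - a) / a + pi/2) / (- (pi/2) + ellK (s p))) F"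
      using ev ev_s filterlim_at_top_dense[THEN iffD1, OF K', rule_format, of 0]
    proof eventually_elim
      case (elim p)
      let ?r = "parRho 0 a (b p)" and ?K = "ellK (s p)" and ?E = "ellE (s p)"
      have bp: "b p > 0" using elim ad by auto
      note rp = parRho_props[OF ad(1), of "b p"]
      have KE: "0 < ?K - ?E" using elliptic_pos(1)[OF ad(1), of "b p" "c p"] elim by (simp add: s_eq)
      have E: "1 \<le> ?E" "?E \<le> pi/2" using ellE_bounds[of "s p"] elim by auto
      have "L p \<le> ?K / (1 - ?r^2)" "?K / (1 - ?r^2) - ?r^2 / (1 - ?r^2)^2 \<le> L p"
        using ellLambda_bounds(2,3)[of "s p" ?r] elim rp by (auto simp: L_eq)
      then have "L p \<le> ?K / (a / b p)" "?K / (a / b p) - ((b p - a) / b p) / (a / b p)^2 \<le> L p"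
        using rp elim by auto
      then have "a / b p * L p \<le> a / b p * (?K / (a / b p))"
          "a / b p * (?K / (a / b p) - ((b p - a) / b p) / (a / b p)^2) \<le> a / b p * L p"
        using ad bp by (intro mult_left_mono; simp)+
      moreover have "a / b p * (?K / (a / b p)) = ?K"
        "a / b p * (?K / (a / b p) - ((b p - a) / b p) / (a / b p)^2) = ?K - (b p - a) / a"
        using ad bp by (simp, simp add: power2_eq_square field_simps)
      ultimately have Lb: "a / b p * L p \<le> ?K" "?K - (b p - a) / a \<le> a / b p * L p"
        by auto
      have ba: "0 \<le> (b p - a) / a" using ad elim by auto
      have "a * L p / (b p * (?K - ?E)) - 1 = (a / b p * L p - (?K - ?E)) / (?K - ?E)"
        using KE by (simp add: diff_divide_distrib)
      then have "norm (a * L p / (b p * (?K - ?E)) - 1) = \<bar>a / b p * L p - (?K - ?E)\<bar> / (?K - ?E)"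
        using KE by simp
      also have "\<dots> \<le> ((b p - a) / a + pi/2) / (- (pi/2) + ?K)"
        using Lb E ba KE elim by (intro frac_le) (auto simp: abs_le_iff)
      finally show ?case .
    qed
    show "((\<lambda>p. ((b p - a) / a + pi/2) / (- (pi/2) + ellK (s p))) \<longlongrightarrow> 0) F"
      using ad by (intro tendsto_divide_0[where c = "(d - a) / a + pi/2"] tendsto_intros b
          filterlim_at_top_imp_at_infinity K') auto
  qed
  from tendsto_add[OF this tendsto_const[of 1]]
  have X: "((\<lambda>p. a * L p / (b p * (ellK (s p) - ellE (s p)))) \<longlongrightarrow> 1) F" by simp
  have "((\<lambda>p. u + x p + y p + 2 * nu - 2 * (x p - u) * (a * L p / (b p * (ellK (s p) - ellE (s p)))))
      \<longlongrightarrow> u + 2 * v + 2 * nu - 2 * (v - u) * 1) F"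
    by (intro tendsto_diff V tendsto_mult X tendsto_const x)
  then have "((\<lambda>p. u + x p + y p + 2 * nu - 2 * (x p - u) * (a * L p / (b p * (ellK (s p) - ellE (s p)))))
      \<longlongrightarrow> 3 * u + 2 * nu) F"
    by (rule tendsto_eq_rhs) (simp add: algebra_simps)
  then show "((\<lambda>p. speed1 nu u (x p) (y p)) \<longlongrightarrow> 3 * u + 2 * nu) F"
    by (rule Lim_transform_eventually)
       (use ev in eventually_elim, use speeds_eq(1)[of nu u] uv in \<open>auto simp: s_def L_def a_def b_def c_def\<close>)
qed

text \<open>Here s tends to 0, and u2 - u1 = s^2 (c - a) b / c. This s^2 cancels the vanishing of K
  - E and of E - (1 - s^2) K, both asymptotic to pi s^2 / 4, which is why the first two speeds share
  the limit \<open>M\<close>.\<close>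

lemma speeds_limit_lower:
  fixes nu u w :: real and x y :: "'a \<Rightarrow> real"
  assumes uw: "- nu < w" "w < u"
    and x: "(x \<longlongrightarrow> w) F" and y: "(y \<longlongrightarrow> w) F"
    and ev: "eventually (\<lambda>p. - nu < x p \<and> x p < y p \<and> y p < u) F"
  defines "M \<equiv> u + 2 * w + 2 * nu - 4 * (w + nu) * (u - w) / (u + nu)"
  shows "((\<lambda>p. speed1 nu (x p) (y p) u) \<longlongrightarrow> M) F"
    and "((\<lambda>p. speed2 nu (x p) (y p) u) \<longlongrightarrow> M) F"
    and "((\<lambda>p. speed3 nu (x p) (y p) u) \<longlongrightarrow> 3 * u + 2 * nu) F"
proof -
  define c d where "c = u + nu" and "d = w + nu"
  define a b where "a p = x p + nu" and "b p = y p + nu" for p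
  define s where "s p = modS nu (x p) (y p) u" for p
  define L where "L p = ellLambda (parRho nu (x p) (y p)) (s p)" for p
  have cd: "0 < d" "d < c" using uw by (auto simp: c_def d_def)
  have a: "(a \<longlongrightarrow> d) F" and b: "(b \<longlongrightarrow> d) F"
    unfolding b_def d_def a_def by (intro tendsto_intros x y)+
  have s_eq: "s p = modS 0 (a p) (b p) c" and L_eq: "L p = ellLambda (parRho 0 (a p) (b p)) (s p)" for p
    unfolding L_def s_def a_def b_def c_def using modS_shift[of nu] parRho_shift[of nu] by auto
  have ev: "eventually (\<lambda>p. 0 < a p \<and> a p < b p \<and> b p < c) F"
    using ev by eventually_elim (auto simp: a_def b_def c_def)
  have "(s \<longlongrightarrow> sqrt ((d - d) * (c + 0) / ((c - d) * (d + 0)))) F"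
    unfolding s_eq modS_def using cd by (intro tendsto_intros a b) auto
  then have s: "(s \<longlongrightarrow> 0) F" by simp
  have ev_s: "eventually (\<lambda>p. 0 \<le> s p \<and> 0 < s p \<and> s p < 1) F"
    using ev by eventually_elim (use modS_props in \<open>auto simp: s_eq less_imp_le\<close>)
  have rt: "((\<lambda>p. C / sqrt (1 - (s p)^2)) \<longlongrightarrow> C) F" for C
  proof -
    have "((\<lambda>p. C / sqrt (1 - (s p)^2)) \<longlongrightarrow> C / sqrt (1 - 0^2)) F"
      by (intro tendsto_intros s) auto
    then show ?thesis by simp
  qed
  have V: "((\<lambda>p. x p + y p + u + 2 * nu) \<longlongrightarrow> w + w + u + 2 * nu) F"
    by (intro tendsto_intros x y)
  have K: "((\<lambda>p. ellK (s p)) \<longlongrightarrow> pi/2) F"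
    by (rule tendsto_sandwich[OF _ _ tendsto_const rt];
        use ev_s in eventually_elim, use ellK_bounds in auto)
  have E: "((\<lambda>p. ellE (s p)) \<longlongrightarrow> pi/2) F"
  proof (rule tendsto_sandwich[OF _ _ _ tendsto_const])
    have "((\<lambda>p. (pi/2) * sqrt (1 - (s p)^2)) \<longlongrightarrow> (pi/2) * sqrt (1 - 0^2)) F"
      by (intro tendsto_intros s)
    then show "((\<lambda>p. (pi/2) * sqrt (1 - (s p)^2)) \<longlongrightarrow> pi/2) F" by simp
  qed (use ev_s in eventually_elim, use ellE_bounds in auto)+
  have KE: "((\<lambda>p. (ellK (s p) - ellE (s p)) / (s p)^2) \<longlongrightarrow> pi/4) F"
    by (rule tendsto_sandwich[OF _ _ tendsto_const rt];
        use ev_s in eventually_elim, use ellK_ellE_difference_bounds(1,2) in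
          \<open>auto simp: pos_le_divide_eq pos_divide_le_eq\<close>)
  have EK: "((\<lambda>p. (ellE (s p) - (1 - (s p)^2) * ellK (s p)) / (s p)^2) \<longlongrightarrow> pi/4) F"
    by (rule tendsto_sandwich[OF _ _ tendsto_const rt];
        use ev_s in eventually_elim, use ellK_ellE_difference_bounds(3,4) in
          \<open>auto simp: pos_le_divide_eq pos_divide_le_eq\<close>)
  \<comment> \<open>Lambda is squeezed between K and K b / a, and b / a tends to 1.\<close>
  have L: "(L \<longlongrightarrow> pi/2) F"
  proof (rule tendsto_sandwich[OF _ _ K])
    have "((\<lambda>p. ellK (s p) / (a p / b p)) \<longlongrightarrow> (pi/2) / (d / d)) F"
      using cd by (intro tendsto_intros K a b) auto
    then show "((\<lambda>p. ellK (s p) / (a p / b p)) \<longlongrightarrow> pi/2) F" using cd by simp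
    show "eventually (\<lambda>p. ellK (s p) \<le> L p) F"
      using ev ev_s by eventually_elim
        (use ellLambda_bounds(1) parRho_props(3,4) in \<open>auto simp: L_eq less_imp_le\<close>)
    show "eventually (\<lambda>p. L p \<le> ellK (s p) / (a p / b p)) F"
      using ev ev_s
    proof eventually_elim
      case (elim p)
      then show ?case
        using ellLambda_bounds(2)[of "s p" "parRho 0 (a p) (b p)"] parRho_props[of "a p" "b p"]
        by (simp add: L_eq)
    qed
  qed

  have "((\<lambda>p. x p + y p + u + 2 * nu + 2 * (u - y p) * (a p * L p / (b p * ellE (s p))))
      \<longlongrightarrow> w + w + u + 2 * nu + 2 * (u - w) * (d * (pi/2) / (d * (pi/2)))) F"
    using cd by (intro tendsto_add[OF V] tendsto_intros x y a b L E) auto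
  then have "((\<lambda>p. x p + y p + u + 2 * nu + 2 * (u - y p) * (a p * L p / (b p * ellE (s p))))
      \<longlongrightarrow> 3 * u + 2 * nu) F"
    by (rule tendsto_eq_rhs) (use cd in simp)
  then show "((\<lambda>p. speed3 nu (x p) (y p) u) \<longlongrightarrow> 3 * u + 2 * nu) F"
    by (rule Lim_transform_eventually)
       (use ev in eventually_elim, use speeds_eq(3)[of nu] in \<open>auto simp: s_def L_def a_def b_def c_def\<close>)

  have gap: "y p - x p = (s p)^2 * ((c - a p) * b p / c)" if "0 < a p" "a p < b p" "b p < c" for p
    unfolding s_eq modS_props(1)[OF that] using that by (simp add: a_def b_def)
  \<comment> \<open>The coefficient 4 in \<open>M\<close> is the prefactor 2 times (pi/2) / (pi/4),
    the ratio of the limits of Lambda and (K - E) / s^2.\<close>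
  have M: "M = w + w + u + 2 * nu - 2 * ((c - d) * d / c * (pi/2) / (pi/4))"
  proof -
    have "z * (pi/2) / (pi/4) = 2 * z" for z by simp
    then show ?thesis by (simp only: M_def c_def d_def) simp
  qed
  have "((\<lambda>p. x p + y p + u + 2 * nu
        - 2 * ((c - a p) * b p / c * (a p / b p * L p) / ((ellK (s p) - ellE (s p)) / (s p)^2)))
      \<longlongrightarrow> w + w + u + 2 * nu - 2 * ((c - d) * d / c * (d / d * (pi/2)) / (pi/4))) F"
    using cd by (intro tendsto_diff[OF V] tendsto_intros a b L KE) auto
  then have "((\<lambda>p. x p + y p + u + 2 * nu
        - 2 * ((c - a p) * b p / c * (a p / b p * L p) / ((ellK (s p) - ellE (s p)) / (s p)^2))) \<longlongrightarrow> M) F"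
    by (rule tendsto_eq_rhs) (use cd in \<open>simp add: M\<close>)
  then show "((\<lambda>p. speed1 nu (x p) (y p) u) \<longlongrightarrow> M) F"
  proof (rule Lim_transform_eventually)
    show "eventually (\<lambda>p. x p + y p + u + 2 * nu
        - 2 * ((c - a p) * b p / c * (a p / b p * L p) / ((ellK (s p) - ellE (s p)) / (s p)^2))
        = speed1 nu (x p) (y p) u) F"
      using ev
    proof eventually_elim
      case (elim p)
      then have h: "- nu < x p" "x p < y p" "y p < u" by (auto simp: a_def b_def c_def)
      show ?case
        unfolding speeds_eq(1)[OF h] s_def[symmetric] L_def[symmetric] a_def[symmetric] b_def[symmetric]
        using gap[of p] elim by simp
    qed
  qed
  have "((\<lambda>p. x p + y p + u + 2 * nu
        - 2 * ((c - a p) * b p / c * ((1 - (s p)^2) * L p) / ((ellE (s p) - (1 - (s p)^2) * ellK (s p)) / (s p)^2)))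
      \<longlongrightarrow> w + w + u + 2 * nu - 2 * ((c - d) * d / c * ((1 - 0^2) * (pi/2)) / (pi/4))) F"
    using cd by (intro tendsto_diff[OF V] tendsto_mult[OF tendsto_const] tendsto_divide[OF _ EK] tendsto_intros a b L s) auto
  then have "((\<lambda>p. x p + y p + u + 2 * nu
        - 2 * ((c - a p) * b p / c * ((1 - (s p)^2) * L p) / ((ellE (s p) - (1 - (s p)^2) * ellK (s p)) / (s p)^2)))
      \<longlongrightarrow> M) F"
    by (rule tendsto_eq_rhs) (simp add: M)
  then show "((\<lambda>p. speed2 nu (x p) (y p) u) \<longlongrightarrow> M) F"
  proof (rule Lim_transform_eventually)
    show "eventually (\<lambda>p. x p + y p + u + 2 * nu
        - 2 * ((c - a p) * b p / c * ((1 - (s p)^2) * L p) / ((ellE (s p) - (1 - (s p)^2) * ellK (s p)) / (s p)^2))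
        = speed2 nu (x p) (y p) u) F"
      using ev
    proof eventually_elim
      case (elim p)
      then have h: "- nu < x p" "x p < y p" "y p < u" by (auto simp: a_def b_def c_def)
      show ?case
        unfolding speeds_eq(2)[OF h] s_def[symmetric] L_def[symmetric]
        using gap[of p] elim by simp
    qed
  qed
qed

text \<open>Hyperbolicity is carried by the types: in Riemann invariants the system is diagonal, and
  its characteristic speeds are real-valued.\<close>

theorem theorem2:
  fixes nu u1 u2 u3 :: real
  assumes h1: "- nu < u1" and h2: "u1 < u2" and h3: "u2 < u3"
  shows
   "(let s = modS nu u1 u2 u3; \<rho> = parRho nu u1 u2; \<Lambda> = ellLambda \<rho> s in
      speed1 nu u1 u2 u3 = u1 + u2 + u3 + 2 * nu
        + 2 * (u1 + nu) * (u1 - u2) * \<Lambda> / ((u2 + nu) * (ellK s - ellE s))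
    \<and> speed2 nu u1 u2 u3 = u1 + u2 + u3 + 2 * nu
        + 2 * (u2 - u1) * \<Lambda> /
          (ellK s - ((u2 + nu) * (u3 - u1)) / ((u1 + nu) * (u3 - u2)) * ellE s)
    \<and> speed3 nu u1 u2 u3 = u1 + u2 + u3 + 2 * nu
        + 2 * (u1 + nu) * (u3 - u2) * \<Lambda> / ((u2 + nu) * ellE s))
    \<and> speed1 nu u1 u2 u3 < speed3 nu u1 u2 u3
    \<and> speed2 nu u1 u2 u3 < speed3 nu u1 u2 u3
    \<and> (\<forall>v. u1 < v \<longrightarrow>
          (\<exists>L. ((\<lambda>p. speed2 nu u1 (fst p) (snd p)) \<longlongrightarrow> L)
                  (at (v, v) within {p. u1 < fst p \<and> fst p < snd p})
             \<and> ((\<lambda>p. speed3 nu u1 (fst p) (snd p)) \<longlongrightarrow> L)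
                  (at (v, v) within {p. u1 < fst p \<and> fst p < snd p}))
        \<and> ((\<lambda>p. speed1 nu u1 (fst p) (snd p)) \<longlongrightarrow> 3 * u1 + 2 * nu)
                  (at (v, v) within {p. u1 < fst p \<and> fst p < snd p}))
    \<and> (\<forall>w. - nu < w \<and> w < u3 \<longrightarrow>
          (\<exists>L. ((\<lambda>p. speed1 nu (fst p) (snd p) u3) \<longlongrightarrow> L)
                  (at (w, w) within {p. - nu < fst p \<and> fst p < snd p \<and> snd p < u3})
             \<and> ((\<lambda>p. speed2 nu (fst p) (snd p) u3) \<longlongrightarrow> L)
                  (at (w, w) within {p. - nu < fst p \<and> fst p < snd p \<and> snd p < u3}))
        \<and> ((\<lambda>p. speed3 nu (fst p) (snd p) u3) \<longlongrightarrow> 3 * u3 + 2 * nu)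
                  (at (w, w) within {p. - nu < fst p \<and> fst p < snd p \<and> snd p < u3}))"
proof -
  define s where "s = modS nu u1 u2 u3"
  define L where "L = ellLambda (parRho nu u1 u2) s"
  have abc: "0 < u1 + nu" "u1 + nu < u2 + nu" "u2 + nu < u3 + nu" using h1 h2 h3 by auto
  have s_eq: "s = modS 0 (u1 + nu) (u2 + nu) (u3 + nu)"
    and L_eq: "L = ellLambda (parRho 0 (u1 + nu) (u2 + nu)) s"
    unfolding L_def s_def using modS_shift[of nu] parRho_shift[of nu] by auto
  note sp = speeds_eq[OF h1 h2 h3, folded s_def, folded L_def]
  note pos = elliptic_pos[OF abc, folded s_eq, folded L_eq]
  \<comment> \<open>The coefficient of E in the second speed is the reciprocal of the complementary
    modulus squared.\<close>
  have s2: "(u2 + nu) * (u3 - u1) / ((u1 + nu) * (u3 - u2)) = 1 / (1 - s^2)"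
    using modS_props(2)[OF abc, folded s_eq] by simp
  have "ellK s - 1 / (1 - s^2) * ellE s = - ((ellE s - (1 - s^2) * ellK s) / (1 - s^2))"
    using pos(5) by (simp add: field_simps)
  then have "speed2 nu u1 u2 u3 = u1 + u2 + u3 + 2 * nu
        + 2 * (u2 - u1) * L / (ellK s - 1 / (1 - s^2) * ellE s)"
    unfolding sp(2) using pos(5) by simp
  moreover have "speed1 nu u1 u2 u3 = u1 + u2 + u3 + 2 * nu
        + 2 * (u1 + nu) * (u1 - u2) * L / ((u2 + nu) * (ellK s - ellE s))"
  proof -
    have "V - 2 * (q - p) * (z * L / w) = V + 2 * z * (p - q) * L / w" for V p q z w :: real
      by (cases "w = 0") (auto simp: field_simps)
    then show ?thesis unfolding sp(1) .
  qed
  moreover have "speed3 nu u1 u2 u3 = u1 + u2 + u3 + 2 * nu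
        + 2 * (u1 + nu) * (u3 - u2) * L / ((u2 + nu) * ellE s)"
    unfolding sp(3) by (simp, simp add: algebra_simps)
  ultimately have formulas: "let s = modS nu u1 u2 u3; \<rho> = parRho nu u1 u2; \<Lambda> = ellLambda \<rho> s in
      speed1 nu u1 u2 u3 = u1 + u2 + u3 + 2 * nu
        + 2 * (u1 + nu) * (u1 - u2) * \<Lambda> / ((u2 + nu) * (ellK s - ellE s))
    \<and> speed2 nu u1 u2 u3 = u1 + u2 + u3 + 2 * nu
        + 2 * (u2 - u1) * \<Lambda> /
          (ellK s - ((u2 + nu) * (u3 - u1)) / ((u1 + nu) * (u3 - u2)) * ellE s)
    \<and> speed3 nu u1 u2 u3 = u1 + u2 + u3 + 2 * nu
        + 2 * (u1 + nu) * (u3 - u2) * \<Lambda> / ((u2 + nu) * ellE s)"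
    unfolding Let_def s_def[symmetric] L_def[symmetric] s2 by blast
  \<comment> \<open>The first two speeds lie strictly below u1 + u2 + u3 + 2 nu and the third
    strictly above it, which yields both inequalities.\<close>
  have "0 < 2 * (u3 - u2) * ((u1 + nu) * L / ((u2 + nu) * ellE s))"
    "0 < 2 * (u2 - u1) * ((u1 + nu) * L / ((u2 + nu) * (ellK s - ellE s)))"
    "0 < 2 * (u2 - u1) * (((1 - s^2) * L) / (ellE s - (1 - s^2) * ellK s))"
    using pos abc by (intro mult_pos_pos divide_pos_pos; linarith)+
  then have order: "speed1 nu u1 u2 u3 < speed3 nu u1 u2 u3" "speed2 nu u1 u2 u3 < speed3 nu u1 u2 u3"
    unfolding sp by linarith+
  \<comment> \<open>The limit lemmas are used with \<open>fst\<close> and \<open>snd\<close> as the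
    coalescing invariants. The common limits are u1 + 2 v + 2 nu and the value \<open>M\<close> of
    \<open>speeds_limit_lower\<close>.\<close>
  have within: "eventually (\<lambda>p. p \<in> A) (at z within A)" for z :: "real \<times> real" and A
    by (simp add: eventually_at_filter)
  have lim: "(fst \<longlongrightarrow> v) (at (v, v) within A)" "(snd \<longlongrightarrow> v) (at (v, v) within A)"
    for v :: real and A :: "(real \<times> real) set"
    using tendsto_fst[OF tendsto_ident_at, of "(v, v)" A] tendsto_snd[OF tendsto_ident_at, of "(v, v)" A]
    by auto
  let ?A = "{p. u1 < fst p \<and> fst p < snd p}"
  let ?B = "{p. - nu < fst p \<and> fst p < snd p \<and> snd p < u3}"
  have upper: "\<forall>v. u1 < v \<longrightarrow>
          (\<exists>L. ((\<lambda>p. speed2 nu u1 (fst p) (snd p)) \<longlongrightarrow> L) (at (v, v) within ?A)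
             \<and> ((\<lambda>p. speed3 nu u1 (fst p) (snd p)) \<longlongrightarrow> L) (at (v, v) within ?A))
        \<and> ((\<lambda>p. speed1 nu u1 (fst p) (snd p)) \<longlongrightarrow> 3 * u1 + 2 * nu) (at (v, v) within ?A)"
    using speeds_limit_upper[OF h1 _ lim within[of ?A, simplified]] by blast
  have lower: "\<forall>w. - nu < w \<and> w < u3 \<longrightarrow>
          (\<exists>L. ((\<lambda>p. speed1 nu (fst p) (snd p) u3) \<longlongrightarrow> L) (at (w, w) within ?B)
             \<and> ((\<lambda>p. speed2 nu (fst p) (snd p) u3) \<longlongrightarrow> L) (at (w, w) within ?B))
        \<and> ((\<lambda>p. speed3 nu (fst p) (snd p) u3) \<longlongrightarrow> 3 * u3 + 2 * nu) (at (w, w) within ?B)"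
    using speeds_limit_lower[OF _ _ lim within[of ?B, simplified]] by blast
  show ?thesis
    by (intro conjI formulas order upper lower)
qed

end
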